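(* Let $I$ be a totally ordered set, let $\{(\mathcal{A}_i,\varphi_i,\psi_i)\}_{i\in I}$ be a family of $\ast$-algebras each endowed with two states (with $\varphi_{0_I}=\psi_{0_I}$ if $I$ has a minimal element $0_I$), and let $\mathcal{H}$, $\xi$, the $\ast$-representations $j_i:\mathcal{A}_i\to B(\mathcal{H})$ and the state $\Phi(T)=\langle T\xi,\xi\rangle$ on $B(\mathcal{H})$ be as defined in the context. Let $i_1,\dots,i_n\in I$ with $i_k\neq i_{k+1}$ for $k=1,\dots,n-1$, and let $a_k\in\mathcal{A}_{i_k}$ for $1\le k\le n$. Then: (i) if $i_1>i_2$, then $$\Phi\big(j_{i_1}(a_1)\cdots j_{i_n}(a_n)\big)=\varphi_{i_1}(a_1)\,\Phi\big(j_{i_2}(a_2)\cdots j_{i_n}(a_n)\big);$$ (ii) if $i_n>i_{n-1}$, then $$\Phi\big(j_{i_1}(a_1)\cdots j_{i_n}(a_n)\big)=\Phi\big(j_{i_1}(a_1)\cdots j_{i_{n-1}}(a_{n-1})\big)\,\varphi_{i_n}(a_n);$$ (iii) if $i_{l-1}<i_l>i_{l+1}$ for some $1<l<n$, then $$\Phi\big(j_{i_1}(a_1)\cdots j_{i_n}(a_n)\big)=\Phi\big(j_{i_1}(a_1)\cdots j_{i_{l-1}}(a_{l-1})\,\psi_{i_l}(a_l)\,j_{i_{l+1}}(a_{l+1})\cdots j_{i_n}(a_n)\big)$$ $$\qquad+\ \Phi\big(j_{i_1}(a_1)\cdots j_{i_{l-1}}(a_{l-1})\big)\,\big[\varphi_{i_l}(a_l)-\psi_{i_l}(a_l)\big]\,\Phi\big(j_{i_{l+1}}(a_{l+1})\cdots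 j_{i_n}(a_n)\big).$$
   Context: For each $j\in I$, $\pi_j,\sigma_j:\mathcal{A}_j\to B(\mathcal{H}_j)$ are $\ast$-representations on a common Hilbert space $\mathcal{H}_j$ with a unit vector $\xi_j$ (obtained from the GNS constructions of $\varphi_j$ and $\psi_j$; $\xi_j$ is not required to be cyclic) such that $\varphi_j(a)=\langle\pi_j(a)\xi_j,\xi_j\rangle$ and $\psi_j(a)=\langle\sigma_j(a)\xi_j,\xi_j\rangle$ for $a\in\mathcal{A}_j$. Inner products are linear in the first variable. Put $\mathcal{H}_j^\circ=\mathcal{H}_j\ominus\mathbb{C}\xi_j$. The monotone product $(\mathcal{H},\xi)$ of the $(\mathcal{H}_j,\xi_j)$ is $$\mathcal{H}=\mathbb{C}\xi\oplus\bigoplus_{n\ge1}\ \bigoplus_{i_1>\dots>i_n}\mathcal{H}_{i_1}^\circ\otimes\cdots\otimes\mathcal{H}_{i_n}^\circ,\qquad \|\xi\|=1.$$ For $k\in I$, $\mathcal{H}(k)$ is the closed subspace consisting of $\mathbb{C}\xi$ and all summands with $i_1\le k$, and $\mathcal{H}(k-1)$ denotes the closed subspace consisting of $\mathbb{C}\xi$ and all summands with $i_1<k$. The partial isometry $V_k:\mathcal{H}\to\mathcal{H}_k\otimes\mathcal{H}(k-1)$ is given by $V_k\xi=\xi_k\otimes\xi$ and, for $f_1\otimes\cdots\otimes f_n\in\mathcal{H}_{i_1}^\circ\otimes\cdots\otimes\mathcal{H}_{i_n}^\circ$ with $i_1>\dots>i_n$: $V_k(f_1\otimes\cdots\otimes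 f_n)=0$ if $i_1>k$; $=f_1\otimes (f_2\otimes\cdots\otimes f_n)$ if $i_1=k$ (read as $f_1\otimes\xi$ when $n=1$); $=\xi_k\otimes (f_1\otimes\cdots\otimes f_n)$ if $i_1<k$. For $T\in B(\mathcal{H}_k)$ let $\omega_k(T)=V_k^*(T\otimes\mathrm{Id}_{\mathcal{H}(k-1)})V_k$. Let $P_k$ be the orthogonal projection of $\mathcal{H}$ onto $\mathbb{C}\xi\oplus\mathcal{H}_k^\circ$. The $\ast$-representation $j_k:\mathcal{A}_k\to B(\mathcal{H})$ is $$j_k(a)=\omega_k(\pi_k(a))P_k+\omega_k(\sigma_k(a))P_k^{\perp}.$$ *)

theory Defs
  imports "HOL-Analysis.Analysis" "HOL-Algebra.Module"
begin

section \<open>Complex Hilbert spaces\<close>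

text \<open>
  The inner product is linear in the first variable. A family of Hilbert spaces is represented by
  a family of closed complex subspaces of one ambient Hilbert space; up to isomorphism this covers
  every family, since the members embed into their Hilbert direct sum.
\<close>

class complex_hilbert_space = banach +
  fixes scaleC :: "complex \<Rightarrow> 'a \<Rightarrow> 'a" (infixr "*\<^sub>C" 75)
    and cinner :: "'a \<Rightarrow> 'a \<Rightarrow> complex"
  assumes scaleC_add_right: "c *\<^sub>C (x + y) = c *\<^sub>C x + c *\<^sub>C y"
    and scaleC_add_left: "(c + d) *\<^sub>C x = c *\<^sub>C x + d *\<^sub>C x"
    and scaleC_scaleC: "c *\<^sub>C d *\<^sub>C x = (c * d) *\<^sub>C x"
    and scaleC_of_real: "complex_of_real r *\<^sub>C x = r *\<^sub>R x"
    and cinner_add_left: "cinner (x + y) z = cinner x z + cinner y z"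
    and cinner_scaleC_left: "cinner (c *\<^sub>C x) y = c * cinner x y"
    and cinner_commute: "cinner x y = cnj (cinner y x)"
    and cinner_self: "cinner x x = complex_of_real ((norm x)\<^sup>2)"

definition csubspace :: "'a::complex_hilbert_space set \<Rightarrow> bool" where
  "csubspace S \<longleftrightarrow>
     0 \<in> S \<and> (\<forall>x\<in>S. \<forall>y\<in>S. x + y \<in> S) \<and> (\<forall>c. \<forall>x\<in>S. c *\<^sub>C x \<in> S)"

definition closed_csubspace :: "'a::complex_hilbert_space set \<Rightarrow> bool" where
  "closed_csubspace S \<longleftrightarrow> csubspace S \<and> closed S"

definition ccspan :: "'a::complex_hilbert_space set \<Rightarrow> 'a set" where
  "ccspan X = closed_csubspace hull X"

text \<open>
  \<open>bounded_op S S' f\<close>: the restriction of \<open>f\<close> to \<open>S\<close> is a bounded operator from \<open>S\<close> to \<open>S'\<close>. The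
  values of \<open>f\<close> outside \<open>S\<close> are irrelevant. For this reason the operators below that are determined
  only on a closed subspace are introduced with \<open>SOME\<close>.
\<close>

definition bounded_op ::
  "'a::complex_hilbert_space set \<Rightarrow> 'b::complex_hilbert_space set \<Rightarrow> ('a \<Rightarrow> 'b) \<Rightarrow> bool" where
  "bounded_op S S' f \<longleftrightarrow>
     (\<forall>x\<in>S. f x \<in> S') \<and>
     (\<forall>x\<in>S. \<forall>y\<in>S. f (x + y) = f x + f y) \<and>
     (\<forall>c. \<forall>x\<in>S. f (c *\<^sub>C x) = c *\<^sub>C f x) \<and>
     (\<exists>C. \<forall>x\<in>S. norm (f x) \<le> C * norm x)"

definition adjoint_op ::
  "'a::complex_hilbert_space set \<Rightarrow> 'b::complex_hilbert_space set \<Rightarrow> ('a \<Rightarrow> 'b) \<Rightarrow> 'b \<Rightarrow> 'a" where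
  "adjoint_op S S' f =
     (SOME g. bounded_op S' S g \<and> (\<forall>x\<in>S. \<forall>y\<in>S'. cinner (f x) y = cinner x (g y)))"

definition orth_proj ::
  "'a::complex_hilbert_space set \<Rightarrow> 'a \<Rightarrow> 'a" where
  "orth_proj S x = (THE y. y \<in> S \<and> (\<forall>z\<in>S. cinner (x - y) z = 0))"

text \<open>
  \<open>hilbert_tensor S S' \<tau>\<close>: the closed span of the elementary tensors \<open>\<tau> x y\<close> is the Hilbert space
  tensor product of \<open>S\<close> and \<open>S'\<close>.
\<close>

definition hilbert_tensor ::
  "'a::complex_hilbert_space set \<Rightarrow> 'b::complex_hilbert_space set
    \<Rightarrow> ('a \<Rightarrow> 'b \<Rightarrow> 'c::complex_hilbert_space) \<Rightarrow> bool" where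
  "hilbert_tensor S S' \<tau> \<longleftrightarrow>
     (\<forall>x\<in>S. \<forall>x'\<in>S. \<forall>y\<in>S'. \<tau> (x + x') y = \<tau> x y + \<tau> x' y) \<and>
     (\<forall>x\<in>S. \<forall>y\<in>S'. \<forall>y'\<in>S'. \<tau> x (y + y') = \<tau> x y + \<tau> x y') \<and>
     (\<forall>c. \<forall>x\<in>S. \<forall>y\<in>S'. \<tau> (c *\<^sub>C x) y = c *\<^sub>C \<tau> x y \<and> \<tau> x (c *\<^sub>C y) = c *\<^sub>C \<tau> x y) \<and>
     (\<forall>x\<in>S. \<forall>x'\<in>S. \<forall>y\<in>S'. \<forall>y'\<in>S'. cinner (\<tau> x y) (\<tau> x' y') = cinner x x' * cinner y y')"


section \<open>*-algebras, states and representations\<close>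

definition complex_ring :: "complex ring" where
  "complex_ring = \<lparr>carrier = UNIV, mult = (*), one = 1, zero = 0, add = (+)\<rparr>"

record 'a star_alg = "(complex, 'a) module" +
  star :: "'a \<Rightarrow> 'a"

text \<open>
  Algebras need not have a unit: the record field \<open>one\<close> is unconstrained and never used.
\<close>

definition star_algebra :: "'a star_alg \<Rightarrow> bool" where
  "star_algebra A \<longleftrightarrow>
     module complex_ring A \<and>
     (\<forall>x\<in>carrier A. \<forall>y\<in>carrier A. x \<otimes>\<^bsub>A\<^esub> y \<in> carrier A) \<and>
     (\<forall>x\<in>carrier A. \<forall>y\<in>carrier A. \<forall>z\<in>carrier A.
        (x \<otimes>\<^bsub>A\<^esub> y) \<otimes>\<^bsub>A\<^esub> z = x \<otimes>\<^bsub>A\<^esub> (y \<otimes>\<^bsub>A\<^esub> z) \<and>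
        (x \<oplus>\<^bsub>A\<^esub> y) \<otimes>\<^bsub>A\<^esub> z = (x \<otimes>\<^bsub>A\<^esub> z) \<oplus>\<^bsub>A\<^esub> (y \<otimes>\<^bsub>A\<^esub> z) \<and>
        x \<otimes>\<^bsub>A\<^esub> (y \<oplus>\<^bsub>A\<^esub> z) = (x \<otimes>\<^bsub>A\<^esub> y) \<oplus>\<^bsub>A\<^esub> (x \<otimes>\<^bsub>A\<^esub> z)) \<and>
     (\<forall>c. \<forall>x\<in>carrier A. \<forall>y\<in>carrier A.
        (c \<odot>\<^bsub>A\<^esub> x) \<otimes>\<^bsub>A\<^esub> y = c \<odot>\<^bsub>A\<^esub> (x \<otimes>\<^bsub>A\<^esub> y) \<and>
        x \<otimes>\<^bsub>A\<^esub> (c \<odot>\<^bsub>A\<^esub> y) = c \<odot>\<^bsub>A\<^esub> (x \<otimes>\<^bsub>A\<^esub> y)) \<and>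
     (\<forall>x\<in>carrier A. star A x \<in> carrier A \<and> star A (star A x) = x) \<and>
     (\<forall>x\<in>carrier A. \<forall>y\<in>carrier A.
        star A (x \<oplus>\<^bsub>A\<^esub> y) = star A x \<oplus>\<^bsub>A\<^esub> star A y \<and>
        star A (x \<otimes>\<^bsub>A\<^esub> y) = star A y \<otimes>\<^bsub>A\<^esub> star A x) \<and>
     (\<forall>c. \<forall>x\<in>carrier A. star A (c \<odot>\<^bsub>A\<^esub> x) = cnj c \<odot>\<^bsub>A\<^esub> star A x)"

text \<open>
  A state is a linear functional whose extension by \<open>1 \<mapsto> 1\<close> to the unitization is positive; the
  positivity condition is positivity on \<open>(x + c 1)\<^sup>* (x + c 1)\<close>. If the algebra has a unit \<open>e\<close>,
  then \<open>\<phi> e = 1\<close> is required, and the definition amounts to positivity together with \<open>\<phi> e = 1\<close>.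
\<close>

definition is_state :: "'a star_alg \<Rightarrow> ('a \<Rightarrow> complex) \<Rightarrow> bool" where
  "is_state A \<phi> \<longleftrightarrow>
     (\<forall>x\<in>carrier A. \<forall>y\<in>carrier A. \<phi> (x \<oplus>\<^bsub>A\<^esub> y) = \<phi> x + \<phi> y) \<and>
     (\<forall>c. \<forall>x\<in>carrier A. \<phi> (c \<odot>\<^bsub>A\<^esub> x) = c * \<phi> x) \<and>
     (\<forall>c. \<forall>x\<in>carrier A.
        \<phi> (star A x \<otimes>\<^bsub>A\<^esub> x) + c * \<phi> (star A x) + cnj c * \<phi> x + cnj c * c \<in> \<real>\<^sub>\<ge>\<^sub>0) \<and>
     (\<forall>e\<in>carrier A. (\<forall>x\<in>carrier A. e \<otimes>\<^bsub>A\<^esub> x = x \<and> x \<otimes>\<^bsub>A\<^esub> e = x) \<longrightarrow> \<phi> e = 1)"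

definition star_rep ::
  "'a star_alg \<Rightarrow> 'h::complex_hilbert_space set \<Rightarrow> ('a \<Rightarrow> 'h \<Rightarrow> 'h) \<Rightarrow> bool" where
  "star_rep A S \<pi> \<longleftrightarrow>
     (\<forall>a\<in>carrier A. bounded_op S S (\<pi> a)) \<and>
     (\<forall>a\<in>carrier A. \<forall>b\<in>carrier A. \<forall>x\<in>S.
        \<pi> (a \<oplus>\<^bsub>A\<^esub> b) x = \<pi> a x + \<pi> b x \<and> \<pi> (a \<otimes>\<^bsub>A\<^esub> b) x = \<pi> a (\<pi> b x)) \<and>
     (\<forall>c. \<forall>a\<in>carrier A. \<forall>x\<in>S. \<pi> (c \<odot>\<^bsub>A\<^esub> a) x = c *\<^sub>C \<pi> a x) \<and>
     (\<forall>a\<in>carrier A. \<forall>x\<in>S. \<forall>y\<in>S. cinner (\<pi> a x) y = cinner x (\<pi> (star A a) y))"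


section \<open>The monotone product\<close>

text \<open>
  \<open>ominus H xi k\<close> is \<open>H k \<ominus> \<complex> (xi k)\<close>.
  The list \<open>[(i\<^sub>1, f\<^sub>1), \<dots>, (i\<^sub>n, f\<^sub>n)]\<close> with \<open>i\<^sub>1 > \<dots> > i\<^sub>n\<close> stands for the elementary
  tensor \<open>f\<^sub>1 \<otimes> \<dots> \<otimes> f\<^sub>n\<close> in the summand indexed by \<open>(i\<^sub>1, \<dots>, i\<^sub>n)\<close>, and \<open>[]\<close> for the vacuum.
\<close>

definition ominus ::
  "('i \<Rightarrow> 'h::complex_hilbert_space set) \<Rightarrow> ('i \<Rightarrow> 'h) \<Rightarrow> 'i \<Rightarrow> 'h set" where
  "ominus H xi k = {f \<in> H k. cinner f (xi k) = 0}"

definition mono_words ::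
  "('i::linorder \<Rightarrow> 'h::complex_hilbert_space set) \<Rightarrow> ('i \<Rightarrow> 'h) \<Rightarrow> ('i \<times> 'h) list set" where
  "mono_words H xi =
     {w. sorted_wrt (>) (map fst w) \<and> (\<forall>(i, f)\<in>set w. f \<in> ominus H xi i)}"

text \<open>
  \<open>mono_below H xi elt k\<close> is the subspace \<open>H(k-1)\<close> of the monotone product: the closed span of the
  vacuum and of the summands with \<open>i\<^sub>1 < k\<close>.
\<close>

definition mono_below ::
  "('i::linorder \<Rightarrow> 'h::complex_hilbert_space set) \<Rightarrow> ('i \<Rightarrow> 'h)
    \<Rightarrow> (('i \<times> 'h) list \<Rightarrow> 'm::complex_hilbert_space) \<Rightarrow> 'i \<Rightarrow> 'm set" where
  "mono_below H xi elt k =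
     ccspan (elt ` {w \<in> mono_words H xi. w = [] \<or> fst (hd w) < k})"

text \<open>
  The whole type \<open>'m\<close> is the monotone product of the pointed Hilbert spaces \<open>(H k, xi k)\<close>:
  \<open>elt\<close> maps words to elementary tensors, is multilinear, has the inner products of the Hilbert
  space tensor products within a summand, makes distinct summands orthogonal, and its values span
  a dense subspace. The vacuum \<open>elt []\<close> is a unit vector by \<open>elt_cinner\<close> (empty product).
  The map \<open>tens k\<close> exhibits the Hilbert space tensor product of \<open>H k\<close> and \<open>H(k-1)\<close>.
\<close>

locale monotone_product =
  fixes H :: "'i::linorder \<Rightarrow> 'h::complex_hilbert_space set"
    and xi :: "'i \<Rightarrow> 'h"
    and elt :: "('i \<times> 'h) list \<Rightarrow> 'm::complex_hilbert_space"
    and tens :: "'i \<Rightarrow> 'h \<Rightarrow> 'm \<Rightarrow> 'k::complex_hilbert_space"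
  assumes H_closed: "closed_csubspace (H k)"
    and xi_in: "xi k \<in> H k"
    and xi_norm: "norm (xi k) = 1"
    and elt_add: "\<lbrakk>u @ (i, f) # v \<in> mono_words H xi; u @ (i, g) # v \<in> mono_words H xi\<rbrakk> \<Longrightarrow>
      elt (u @ (i, f + g) # v) = elt (u @ (i, f) # v) + elt (u @ (i, g) # v)"
    and elt_scaleC: "u @ (i, f) # v \<in> mono_words H xi \<Longrightarrow>
      elt (u @ (i, c *\<^sub>C f) # v) = c *\<^sub>C elt (u @ (i, f) # v)"
    and elt_cinner: "\<lbrakk>w \<in> mono_words H xi; w' \<in> mono_words H xi\<rbrakk> \<Longrightarrow>
      cinner (elt w) (elt w') =
        (if map fst w = map fst w'
         then (\<Prod>n<length w. cinner (snd (w ! n)) (snd (w' ! n))) else 0)"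
    and elt_total: "ccspan (elt ` mono_words H xi) = UNIV"
    and tens_tensor: "hilbert_tensor (H k) (mono_below H xi elt k) (tens k)"
begin

definition vacuum :: 'm where
  "vacuum = elt []"

definition tens_space :: "'i \<Rightarrow> 'k set" where
  "tens_space k = ccspan {tens k x y | x y. x \<in> H k \<and> y \<in> mono_below H xi elt k}"

definition V :: "'i \<Rightarrow> 'm \<Rightarrow> 'k" where
  "V k = (SOME v. bounded_op UNIV (tens_space k) v \<and>
     v vacuum = tens k (xi k) vacuum \<and>
     (\<forall>i f w. (i, f) # w \<in> mono_words H xi \<longrightarrow>
        v (elt ((i, f) # w)) =
          (if i > k then 0
           else if i = k then tens k f (elt w)
           else tens k (xi k) (elt ((i, f) # w)))))"

definition tens_id :: "'i \<Rightarrow> ('h \<Rightarrow> 'h) \<Rightarrow> 'k \<Rightarrow> 'k" where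
  "tens_id k T = (SOME R. bounded_op (tens_space k) (tens_space k) R \<and>
     (\<forall>x\<in>H k. \<forall>y\<in>mono_below H xi elt k. R (tens k x y) = tens k (T x) y))"

definition \<omega> :: "'i \<Rightarrow> ('h \<Rightarrow> 'h) \<Rightarrow> 'm \<Rightarrow> 'm" where
  "\<omega> k T = adjoint_op UNIV (tens_space k) (V k) \<circ> tens_id k T \<circ> V k"

definition P :: "'i \<Rightarrow> 'm \<Rightarrow> 'm" where
  "P k = orth_proj (ccspan (insert vacuum {elt [(k, f)] | f. f \<in> ominus H xi k}))"

definition j_rep ::
  "('i \<Rightarrow> 'a \<Rightarrow> 'h \<Rightarrow> 'h) \<Rightarrow> ('i \<Rightarrow> 'a \<Rightarrow> 'h \<Rightarrow> 'h) \<Rightarrow> 'i \<Rightarrow> 'a \<Rightarrow> 'm \<Rightarrow> 'm" where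
  "j_rep \<pi> \<sigma> k a x = \<omega> k (\<pi> k a) (P k x) + \<omega> k (\<sigma> k a) (x - P k x)"

definition vacuum_state :: "('m \<Rightarrow> 'm) \<Rightarrow> complex" where
  "vacuum_state T = cinner (T vacuum) vacuum"

end

text \<open>\<open>op_prod X m l\<close> is the operator product \<open>X m \<circ> X (m + 1) \<circ> \<dots> \<circ> X l\<close>.\<close>

definition op_prod :: "(nat \<Rightarrow> 'm \<Rightarrow> 'm) \<Rightarrow> nat \<Rightarrow> nat \<Rightarrow> 'm \<Rightarrow> 'm" where
  "op_prod X m l = foldr (\<circ>) (map X [m..<Suc l]) id"

end

theory Submission
  imports Defs
begin

text \<open>
  For \<open>u \<in> H(m-1)\<close> one has \<open>P\<^sub>m u = \<langle>u, \<xi>\<rangle> \<xi>\<close> and \<open>V\<^sub>m u = \<xi>\<^sub>m \<otimes> u\<close>, so the compression of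
  \<open>\<omega>\<^sub>m(T)\<close> to \<open>H(m-1)\<close> is the scalar \<open>\<langle>T \<xi>\<^sub>m, \<xi>\<^sub>m\<rangle>\<close>, and
  \<open>j\<^sub>m(a) u = \<psi>\<^sub>m(a) u + (\<phi>\<^sub>m(a) - \<psi>\<^sub>m(a)) \<langle>u, \<xi>\<rangle> \<xi> + r\<close> with \<open>r\<close> orthogonal to \<open>H(m-1)\<close>.
  If \<open>k < m\<close>, then \<open>j\<^sub>k(b)\<close> has range in \<open>H(m-1)\<close> and annihilates \<open>r\<close>. So at a peak of the index
  sequence the remainder \<open>r\<close> is killed by the operator on the left, or, at the left end, by the
  vacuum vector.

  The operators \<open>V\<^sub>m\<close>, \<open>V\<^sub>m\<^sup>*\<close> and \<open>T \<otimes> Id\<close> are defined by \<open>SOME\<close>, so their existence has to be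
  proved: by extension from a total set, with equal Gram matrices for \<open>V\<^sub>m\<close>, and with a norm bound
  from Gram-Schmidt in the second tensor factor for \<open>T \<otimes> Id\<close>.
\<close>

section \<open>Hilbert space geometry\<close>

lemma scaleC_zero_left [simp]: "0 *\<^sub>C x = (0 :: 'a::complex_hilbert_space)"
  using scaleC_of_real[of 0 x] by simp

lemma scaleC_one [simp]: "1 *\<^sub>C x = (x :: 'a::complex_hilbert_space)"
  using scaleC_of_real[of 1 x] by simp

lemma scaleC_minus_one: "(-1) *\<^sub>C x = - (x :: 'a::complex_hilbert_space)"
  using scaleC_of_real[of "-1" x] by simp

lemma scaleC_zero_right [simp]: "c *\<^sub>C 0 = (0 :: 'a::complex_hilbert_space)"
  using scaleC_add_right[of c 0 "0::'a"] by simp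

lemma scaleC_diff_right: "c *\<^sub>C (x - y) = c *\<^sub>C x - c *\<^sub>C (y :: 'a::complex_hilbert_space)"
  using scaleC_add_right[of c "x - y" y] by (simp add: algebra_simps)

lemma cinner_add_right: "cinner x (y + z) = cinner x y + cinner x (z :: 'a::complex_hilbert_space)"
  by (metis cinner_add_left cinner_commute complex_cnj_add)

lemma cinner_scaleC_right: "cinner x (c *\<^sub>C y) = cnj c * cinner x (y :: 'a::complex_hilbert_space)"
  by (metis cinner_scaleC_left cinner_commute complex_cnj_mult)

lemma cinner_zero_left [simp]: "cinner 0 (y :: 'a::complex_hilbert_space) = 0"
  using cinner_add_left[of 0 0 y] by simp

lemma cinner_zero_right [simp]: "cinner (y :: 'a::complex_hilbert_space) 0 = 0"
  using cinner_add_right[of y 0 0] by simp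

lemma cinner_diff_left: "cinner (x - y) z = cinner x z - cinner y (z :: 'a::complex_hilbert_space)"
  using cinner_add_left[of "x - y" y z] by (simp add: algebra_simps)

lemma cinner_diff_right: "cinner x (y - z) = cinner x y - cinner x (z :: 'a::complex_hilbert_space)"
  using cinner_add_right[of x "y - z" z] by (simp add: algebra_simps)

lemma cinner_eq_zero_commute: "cinner x y = 0 \<longleftrightarrow> cinner y (x :: 'a::complex_hilbert_space) = 0"
  by (metis cinner_commute complex_cnj_zero_iff)

lemma cinner_self_eq_zero_iff [simp]: "cinner x x = 0 \<longleftrightarrow> x = (0 :: 'a::complex_hilbert_space)"
  by (simp add: cinner_self)

lemma cinner_sum_list_left:
  "cinner (\<Sum>a\<leftarrow>l. f a) y = (\<Sum>a\<leftarrow>l. cinner (f a) (y :: 'a::complex_hilbert_space))"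
  by (induction l) (auto simp: cinner_add_left)

lemma cinner_sum_list_right:
  "cinner (y :: 'a::complex_hilbert_space) (\<Sum>a\<leftarrow>l. f a) = (\<Sum>a\<leftarrow>l. cinner y (f a))"
  by (induction l) (auto simp: cinner_add_right)

lemma norm_scaleC: "norm (c *\<^sub>C (x :: 'a::complex_hilbert_space)) = cmod c * norm x"
proof -
  have "complex_of_real ((norm (c *\<^sub>C x))\<^sup>2) = c * cnj c * complex_of_real ((norm x)\<^sup>2)"
    by (metis cinner_self cinner_scaleC_left cinner_scaleC_right mult.assoc)
  also have "\<dots> = complex_of_real ((cmod c * norm x)\<^sup>2)"
    by (simp add: complex_norm_square[symmetric] power_mult_distrib flip: of_real_power)
  finally have "(norm (c *\<^sub>C x))\<^sup>2 = (cmod c * norm x)\<^sup>2"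
    using of_real_eq_iff by blast
  then show ?thesis by (simp add: power2_eq_iff_nonneg)
qed

lemma norm_add_square:
  "(norm (x + y))\<^sup>2 = (norm x)\<^sup>2 + (norm y)\<^sup>2 + 2 * Re (cinner x (y :: 'a::complex_hilbert_space))"
proof -
  have "complex_of_real ((norm (x + y))\<^sup>2)
      = cinner x x + cinner y y + (cinner x y + cnj (cinner x y))"
    unfolding cinner_self[symmetric] using cinner_commute[of y x]
    by (simp add: cinner_add_left cinner_add_right)
  also have "\<dots> = complex_of_real ((norm x)\<^sup>2 + (norm y)\<^sup>2 + 2 * Re (cinner x y))"
    by (simp add: cinner_self complex_add_cnj)
  finally show ?thesis using of_real_eq_iff by blast
qed

lemma norm_diff_square:
  "(norm (x - y))\<^sup>2 = (norm x)\<^sup>2 + (norm y)\<^sup>2 - 2 * Re (cinner x (y :: 'a::complex_hilbert_space))"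
  using norm_add_square[of "x - y" y]
  by (simp add: cinner_diff_left cinner_self algebra_simps power2_eq_square)

text \<open>Moving \<open>x\<close> along \<open>z\<close> by a real multiple of the coefficient
  \<open>cinner x z\<close> makes the squared distance a real quadratic polynomial in
  \<open>t\<close>. Cauchy-Schwarz and the variational step of the projection theorem come from two
  choices of \<open>t\<close>.\<close>

lemma norm_diff_scaleC_cinner:
  fixes x z :: "'a::complex_hilbert_space"
  shows "(norm (x - (complex_of_real t * cinner x z) *\<^sub>C z))\<^sup>2
    = (norm x)\<^sup>2 - 2 * t * (cmod (cinner x z))\<^sup>2 + t\<^sup>2 * (cmod (cinner x z))\<^sup>2 * (norm z)\<^sup>2"
proof -
  have "Re (cnj (cinner x z) * cinner x z) = (cmod (cinner x z))\<^sup>2"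
    by (metis complex_norm_square mult.commute of_real_eq_iff Re_complex_of_real)
  then show ?thesis
    by (simp add: norm_diff_square norm_scaleC cinner_scaleC_right norm_mult power_mult_distrib
        algebra_simps)
qed

lemma cinner_Cauchy_Schwarz: "cmod (cinner x z) \<le> norm x * norm (z :: 'a::complex_hilbert_space)"
proof (cases "z = 0")
  case False
  \<comment> \<open>With this \<open>t\<close> the subtracted vector is the projection of
    \<open>x\<close> onto the line through \<open>z\<close>, where the quadratic is minimal.\<close>
  let ?t = "1 / (norm z)\<^sup>2"
  have "0 \<le> (norm x)\<^sup>2 - 2 * ?t * (cmod (cinner x z))\<^sup>2
      + ?t\<^sup>2 * (cmod (cinner x z))\<^sup>2 * (norm z)\<^sup>2"
    by (metis norm_diff_scaleC_cinner zero_le_power2)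
  also have "\<dots> = (norm x)\<^sup>2 - (cmod (cinner x z))\<^sup>2 / (norm z)\<^sup>2"
    using False by (simp add: field_simps power2_eq_square)
  finally have "(cmod (cinner x z))\<^sup>2 \<le> (norm x * norm z)\<^sup>2"
    using False by (simp add: field_simps power_mult_distrib)
  then show ?thesis by (rule power2_le_imp_le) simp
qed simp

lemma bounded_linear_cinner_left: "bounded_linear (\<lambda>x. cinner x (y :: 'a::complex_hilbert_space))"
  by (rule bounded_linear_intro[where K = "norm y"])
     (auto simp: cinner_add_left cinner_Cauchy_Schwarz cinner_scaleC_left scaleR_conv_of_real
       simp flip: scaleC_of_real)

lemma bounded_linear_cinner_right: "bounded_linear (\<lambda>y. cinner (x :: 'a::complex_hilbert_space) y)"
  by (rule bounded_linear_intro[where K = "norm x"])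
     (auto simp: cinner_add_right cinner_Cauchy_Schwarz cinner_scaleC_right scaleR_conv_of_real
       mult.commute simp flip: scaleC_of_real intro: order_trans[OF cinner_Cauchy_Schwarz])

lemma bounded_linear_scaleC: "bounded_linear (\<lambda>x. c *\<^sub>C (x :: 'a::complex_hilbert_space))"
  by (rule bounded_linear_intro[where K = "cmod c"])
     (auto simp: scaleC_add_right norm_scaleC scaleC_scaleC mult.commute simp flip: scaleC_of_real)

lemmas continuous_on_cinner_left [continuous_intros] =
  bounded_linear.continuous_on[OF bounded_linear_cinner_left]
lemmas continuous_on_cinner_right [continuous_intros] =
  bounded_linear.continuous_on[OF bounded_linear_cinner_right]

section \<open>Closed complex subspaces, orthogonality and projections\<close>

lemma csubspace_0: "csubspace S \<Longrightarrow> 0 \<in> S"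
  and csubspace_add: "csubspace S \<Longrightarrow> x \<in> S \<Longrightarrow> y \<in> S \<Longrightarrow> x + y \<in> S"
  and csubspace_scaleC: "csubspace S \<Longrightarrow> x \<in> S \<Longrightarrow> c *\<^sub>C x \<in> S"
  by (auto simp: csubspace_def)

lemma csubspace_minus: "csubspace S \<Longrightarrow> x \<in> S \<Longrightarrow> - x \<in> S"
  by (metis csubspace_scaleC scaleC_minus_one)

lemma csubspace_diff: "csubspace S \<Longrightarrow> x \<in> S \<Longrightarrow> y \<in> S \<Longrightarrow> x - y \<in> S"
  by (metis csubspace_add csubspace_minus diff_conv_add_uminus)

lemma csubspace_sum_list:
  "csubspace S \<Longrightarrow> (\<And>a. a \<in> set l \<Longrightarrow> f a \<in> S) \<Longrightarrow> (\<Sum>a\<leftarrow>l. f a) \<in> S"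
  by (induction l) (auto simp: csubspace_0 csubspace_add)

lemma csubspace_UNIV [simp]: "csubspace UNIV"
  by (simp add: csubspace_def)

lemma closed_csubspace_ccspan: "closed_csubspace (ccspan X)"
  unfolding ccspan_def
  by (rule hull_in) (auto simp: closed_csubspace_def csubspace_def)

lemma csubspace_ccspan [simp]: "csubspace (ccspan X)"
  and closed_ccspan [simp]: "closed (ccspan X)"
  using closed_csubspace_ccspan by (auto simp: closed_csubspace_def)

lemma ccspan_base: "x \<in> X \<Longrightarrow> x \<in> ccspan X"
  by (simp add: ccspan_def hull_inc)

lemma ccspan_minimal: "X \<subseteq> S \<Longrightarrow> closed_csubspace S \<Longrightarrow> ccspan X \<subseteq> S"
  by (simp add: ccspan_def hull_minimal)

lemma closed_csubspace_orthogonal: "closed_csubspace {x. \<forall>z\<in>X. cinner x z = 0}"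
proof -
  have "closed (\<Inter>z\<in>X. {x. cinner x z = 0})"
    by (intro closed_INT ballI closed_Collect_eq continuous_intros)
  moreover have "(\<Inter>z\<in>X. {x. cinner x z = 0}) = {x. \<forall>z\<in>X. cinner x z = 0}" by auto
  ultimately show ?thesis
    by (auto simp: closed_csubspace_def csubspace_def cinner_add_left cinner_scaleC_left)
qed

text \<open>The orthogonal complement of the single vector \<open>x\<close> is a closed subspace, so
  it contains the hull as soon as it contains the generators.\<close>

lemma orthogonal_ccspan:
  assumes "\<And>z. z \<in> X \<Longrightarrow> cinner x z = 0" and "z \<in> ccspan X"
  shows "cinner x z = 0"
proof -
  have "ccspan X \<subseteq> {z. \<forall>y\<in>{x}. cinner z y = 0}"
    using assms(1) by (intro ccspan_minimal closed_csubspace_orthogonal)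
      (auto simp: cinner_eq_zero_commute)
  then show ?thesis using assms(2) cinner_eq_zero_commute by blast
qed

text \<open>A minimizing sequence for the distance from \<open>x\<close> to \<open>S\<close> is
  Cauchy by the parallelogram identity, so completeness gives a nearest point \<open>y\<close>.
  Moving \<open>y\<close> inside \<open>S\<close> along any \<open>z\<close> cannot decrease the
  distance, which forces \<open>x - y\<close> to be orthogonal to \<open>z\<close>.\<close>

theorem closed_csubspace_projection:
  fixes S :: "'a::complex_hilbert_space set"
  assumes S: "closed_csubspace S"
  obtains y where "y \<in> S" "\<And>z. z \<in> S \<Longrightarrow> cinner (x - y) z = 0"
proof -
  have cs: "csubspace S" and cl: "closed S" using S by (auto simp: closed_csubspace_def)
  define d where "d = Inf ((\<lambda>y. (norm (x - y))\<^sup>2) ` S)"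
  have bdd: "bdd_below ((\<lambda>y. (norm (x - y))\<^sup>2) ` S)" by (rule bdd_belowI[of _ 0]) auto
  have d_le: "d \<le> (norm (x - y))\<^sup>2" if "y \<in> S" for y
    unfolding d_def using that bdd by (intro cInf_lower) auto
  have "\<exists>y\<in>S. (norm (x - y))\<^sup>2 < d + inverse (real (Suc n))" for n
  proof (rule ccontr)
    assume "\<not> ?thesis"
    then have "d + inverse (real (Suc n)) \<le> Inf ((\<lambda>y. (norm (x - y))\<^sup>2) ` S)"
      using csubspace_0[OF cs] by (intro cInf_greatest) (auto simp: not_less)
    then show False unfolding d_def[symmetric] by (simp del: of_nat_Suc)
  qed
  then obtain s where sS: "\<And>n. s n \<in> S"
    and s: "\<And>n. (norm (x - s n))\<^sup>2 < d + inverse (real (Suc n))" by metis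
  have dist_s: "(norm (s n - s m))\<^sup>2 \<le> 2 * inverse (real (Suc n)) + 2 * inverse (real (Suc m))" for n m
  proof -
    let ?a = "x - s m" and ?b = "x - s n"
    have par: "(norm (?a + ?b))\<^sup>2 + (norm (?a - ?b))\<^sup>2 = 2 * (norm ?a)\<^sup>2 + 2 * (norm ?b)\<^sup>2"
      unfolding norm_add_square norm_diff_square by simp
    \<comment> \<open>The midpoint of two members of the sequence is again in \<open>S\<close>, so
      its squared distance from \<open>x\<close> is at least \<open>d\<close>; the parallelogram
      identity then bounds the distance between the two members.\<close>
    have "(1/2) *\<^sub>C (s m + s n) \<in> S" using cs sS by (simp add: csubspace_add csubspace_scaleC)
    then have "d \<le> (norm (x - (1/2) *\<^sub>C (s m + s n)))\<^sup>2" by (rule d_le)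
    also have "x - (1/2) *\<^sub>C (s m + s n) = (1/2) *\<^sub>R (?a + ?b)"
      using scaleC_of_real[of "1/2" "s m + s n"] by (simp add: algebra_simps flip: scaleR_2)
    finally have "4 * d \<le> (norm (?a + ?b))\<^sup>2" by (simp add: power_divide)
    moreover have "?a - ?b = s n - s m" by simp
    ultimately show ?thesis using par s[of n] s[of m] by auto
  qed
  have "Cauchy s"
  proof (rule CauchyI)
    fix e :: real assume e: "0 < e"
    \<comment> \<open>The estimate \<open>dist_s\<close> has two terms, each at most
      \<open>2 * inverse (real (Suc N))\<close>, hence the factor 4.\<close>
    obtain N where N: "inverse (real (Suc N)) < e\<^sup>2 / 4"
      using reals_Archimedean[of "e\<^sup>2 / 4"] e by auto
    have "norm (s m - s n) < e" if "N \<le> m" "N \<le> n" for m n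
    proof -
      have "inverse (real (Suc m)) \<le> inverse (real (Suc N))"
        "inverse (real (Suc n)) \<le> inverse (real (Suc N))"
        using that by (auto intro!: le_imp_inverse_le)
      then have "(norm (s m - s n))\<^sup>2 < e\<^sup>2" using dist_s[of m n] N by linarith
      then show ?thesis using e by (simp add: power2_less_imp_less)
    qed
    then show "\<exists>M. \<forall>m\<ge>M. \<forall>n\<ge>M. norm (s m - s n) < e" by blast
  qed
  then obtain y where y: "s \<longlonglongrightarrow> y" using Cauchy_convergent convergent_def by blast
  have yS: "y \<in> S" using closed_sequentially[OF cl, of s] sS y by blast
  have "(\<lambda>n. d + inverse (real (Suc n))) \<longlonglongrightarrow> d + 0"
    by (intro tendsto_intros LIMSEQ_inverse_real_of_nat)
  moreover have "(\<lambda>n. (norm (x - s n))\<^sup>2) \<longlonglongrightarrow> (norm (x - y))\<^sup>2"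
    by (intro tendsto_intros y)
  ultimately have min: "(norm (x - y))\<^sup>2 \<le> d"
    using s by (intro LIMSEQ_le[of "\<lambda>n. (norm (x - s n))\<^sup>2"]) (auto intro: less_imp_le)
  have "cinner (x - y) z = 0" if z: "z \<in> S" for z
  proof -
    define N where "N = (norm z)\<^sup>2"
    define C where "C = (cmod (cinner (x - y) z))\<^sup>2"
    \<comment> \<open>The minimizing value would be \<open>1 / N\<close>, but \<open>N\<close>
      vanishes for \<open>z = 0\<close>. With \<open>1 / (N + 1)\<close> no case distinction arises,
      and clearing denominators still leaves \<open>- C * (N + 2)\<close>.\<close>
    define t where "t = 1 / (N + 1)"
    have N: "0 \<le> N" and C: "0 \<le> C" by (auto simp: N_def C_def)
    have "y + (complex_of_real t * cinner (x - y) z) *\<^sub>C z \<in> S"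
      using cs yS z by (simp add: csubspace_add csubspace_scaleC)
    from d_le[OF this] min
    have "0 \<le> - 2 * t * C + t\<^sup>2 * C * N"
      using norm_diff_scaleC_cinner[of "x - y" t z] by (simp add: C_def N_def diff_diff_eq)
    then have "0 \<le> (- 2 * t * C + t\<^sup>2 * C * N) * (N + 1)\<^sup>2" using N by simp
    also have "\<dots> = - 2 * C * (N + 1) + C * N"
    proof -
      have "t * (N + 1) = 1" using N by (simp add: t_def)
      then have "- 2 * C * (t * (N + 1)) * (N + 1) + C * N * (t * (N + 1))\<^sup>2
          = - 2 * C * (N + 1) + C * N" by simp
      then show ?thesis by (simp add: power2_eq_square algebra_simps)
    qed
    finally have "C * (N + 2) \<le> 0" by (simp add: algebra_simps)
    then have "C = 0" using N C by (simp add: mult_le_0_iff)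
    then show ?thesis by (simp add: C_def)
  qed
  with yS that show thesis by blast
qed

lemma orth_proj_eqI:
  assumes "csubspace S" "y \<in> S" "\<And>z. z \<in> S \<Longrightarrow> cinner (x - y) z = 0"
  shows "orth_proj S x = y"
  unfolding orth_proj_def
proof (rule the_equality)
  fix y' assume y': "y' \<in> S \<and> (\<forall>z\<in>S. cinner (x - y') z = 0)"
  then have "y' - y \<in> S" using assms by (simp add: csubspace_diff)
  \<comment> \<open>Both residuals are orthogonal to \<open>S\<close>, and their difference
    \<open>y' - y\<close> lies in \<open>S\<close>; hence it is orthogonal to itself.\<close>
  then have "cinner ((x - y) - (x - y')) (y' - y) = 0" using assms y' by (simp add: cinner_diff_left)
  then show "y' = y" by simp
qed (use assms in auto)

lemma orth_proj:
  assumes "closed_csubspace S"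
  shows orth_proj_in: "orth_proj S x \<in> S"
    and orth_proj_orthogonal: "z \<in> S \<Longrightarrow> cinner (x - orth_proj S x) z = 0"
proof -
  obtain y where y: "y \<in> S" "\<And>z. z \<in> S \<Longrightarrow> cinner (x - y) z = 0"
    using closed_csubspace_projection[OF assms] by blast
  then have "orth_proj S x = y"
    using assms by (intro orth_proj_eqI) (auto simp: closed_csubspace_def)
  with y show "orth_proj S x \<in> S" "z \<in> S \<Longrightarrow> cinner (x - orth_proj S x) z = 0" by auto
qed

lemma bounded_op_orth_proj:
  assumes S: "closed_csubspace S"
  shows "bounded_op UNIV S (orth_proj S)"
proof -
  have cs: "csubspace S" using S by (simp add: closed_csubspace_def)
  note op = orth_proj[OF S]
  have "orth_proj S (x + y) = orth_proj S x + orth_proj S y" for x y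
  proof (rule orth_proj_eqI[OF cs])
    show "cinner (x + y - (orth_proj S x + orth_proj S y)) z = 0" if "z \<in> S" for z
      using op(2)[OF that, of x] op(2)[OF that, of y] by (simp add: cinner_diff_left cinner_add_left)
  qed (simp add: op cs csubspace_add)
  moreover have "orth_proj S (c *\<^sub>C x) = c *\<^sub>C orth_proj S x" for c x
  proof (rule orth_proj_eqI[OF cs])
    show "cinner (c *\<^sub>C x - c *\<^sub>C orth_proj S x) z = 0" if "z \<in> S" for z
      using op(2)[OF that, of x] by (simp add: cinner_scaleC_left flip: scaleC_diff_right)
  qed (simp add: op cs csubspace_scaleC)
  moreover have "norm (orth_proj S x) \<le> 1 * norm x" for x
  proof -
    have "(norm x)\<^sup>2 = (norm (x - orth_proj S x))\<^sup>2 + (norm (orth_proj S x))\<^sup>2"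
      using norm_add_square[of "x - orth_proj S x" "orth_proj S x"] op(2)[OF op(1)] by simp
    then show ?thesis by (simp add: power2_le_imp_le)
  qed
  ultimately show ?thesis unfolding bounded_op_def using op(1) by blast
qed

text \<open>The projection \<open>q\<close> of \<open>v\<close> onto \<open>ccspan X\<close> is also
  orthogonal to \<open>Y\<close>; so \<open>v - q\<close> is orthogonal to the total set
  \<open>X \<union> Y\<close> and vanishes.\<close>

lemma mem_ccspan_if_orthogonal:
  assumes total: "ccspan (X \<union> Y) = UNIV"
    and XY: "\<And>x y. x \<in> X \<Longrightarrow> y \<in> Y \<Longrightarrow> cinner x y = 0"
    and v: "\<And>y. y \<in> Y \<Longrightarrow> cinner v y = 0"
  shows "v \<in> ccspan X"
proof -
  obtain q where q: "q \<in> ccspan X" "\<And>z. z \<in> ccspan X \<Longrightarrow> cinner (v - q) z = 0"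
    using closed_csubspace_projection[OF closed_csubspace_ccspan] by blast
  have "cinner q y = 0" if "y \<in> Y" for y
    using orthogonal_ccspan[of X y q] XY that q(1) cinner_eq_zero_commute by metis
  then have "cinner (v - q) z = 0" if "z \<in> X \<union> Y" for z
    using that q(2) ccspan_base v by (auto simp: cinner_diff_left)
  then have "cinner (v - q) (v - q) = 0"
    using orthogonal_ccspan[of "X \<union> Y"] total by blast
  then show ?thesis using q(1) by simp
qed

section \<open>Bounded operators\<close>

lemma bounded_opD:
  assumes "bounded_op S S' f"
  shows bounded_op_in: "x \<in> S \<Longrightarrow> f x \<in> S'"
    and bounded_op_add: "x \<in> S \<Longrightarrow> y \<in> S \<Longrightarrow> f (x + y) = f x + f y"
    and bounded_op_scaleC: "x \<in> S \<Longrightarrow> f (c *\<^sub>C x) = c *\<^sub>C f x"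
  using assms by (auto simp: bounded_op_def)

lemma bounded_op_zero: "bounded_op S S' f \<Longrightarrow> csubspace S \<Longrightarrow> f 0 = 0"
  using bounded_op_scaleC[of S S' f 0 0] csubspace_0 by auto

lemma bounded_op_diff:
  "\<lbrakk>bounded_op S S' f; csubspace S; x \<in> S; y \<in> S\<rbrakk> \<Longrightarrow> f (x - y) = f x - f y"
  using bounded_op_add[of S S' f "x - y" y] csubspace_diff[of S x y] by simp

lemma bounded_op_sum_list:
  "\<lbrakk>bounded_op S S' f; csubspace S; \<And>a. a \<in> set l \<Longrightarrow> g a \<in> S\<rbrakk>
    \<Longrightarrow> f (\<Sum>a\<leftarrow>l. g a) = (\<Sum>a\<leftarrow>l. f (g a))"
  by (induction l) (auto simp: bounded_op_zero bounded_op_add csubspace_sum_list)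

text \<open>The constant in \<open>bounded_op\<close> may be negative if \<open>S\<close> contains
  no nonzero vector; its absolute value has the sign that Lipschitz estimates and products of bounds
  need.\<close>

lemma bounded_op_bound:
  assumes "bounded_op S S' f"
  obtains C where "0 \<le> C" "\<And>x. x \<in> S \<Longrightarrow> norm (f x) \<le> C * norm x"
proof -
  obtain C where C: "\<And>x. x \<in> S \<Longrightarrow> norm (f x) \<le> C * norm x"
    using assms unfolding bounded_op_def by blast
  have "norm (f x) \<le> \<bar>C\<bar> * norm x" if "x \<in> S" for x
    using C[OF that] by (meson abs_ge_self mult_right_mono norm_ge_zero order_trans)
  then show thesis using that[of "\<bar>C\<bar>"] by simp
qed

lemma bounded_op_continuous_on:
  assumes f: "bounded_op S S' f" and S: "csubspace S"
  shows "continuous_on S f"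
proof -
  obtain C where C: "0 \<le> C" "\<And>x. x \<in> S \<Longrightarrow> norm (f x) \<le> C * norm x"
    using bounded_op_bound[OF f] by blast
  then have "C-lipschitz_on S f"
    by (intro lipschitz_onI)
       (auto simp: dist_norm csubspace_diff[OF S] simp flip: bounded_op_diff[OF f S])
  then show ?thesis by (rule lipschitz_on_continuous_on)
qed

lemma bounded_op_compose:
  assumes f: "bounded_op S S' f" and g: "bounded_op S' S'' g"
  shows "bounded_op S S'' (\<lambda>x. g (f x))"
proof -
  obtain C where C: "\<And>x. x \<in> S \<Longrightarrow> norm (f x) \<le> C * norm x"
    using bounded_op_bound[OF f] by blast
  obtain D where D: "0 \<le> D" "\<And>x. x \<in> S' \<Longrightarrow> norm (g x) \<le> D * norm x"
    using bounded_op_bound[OF g] by blast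
  have "norm (g (f x)) \<le> (D * C) * norm x" if "x \<in> S" for x
    using D(2)[OF bounded_op_in[OF f that]] mult_left_mono[OF C[OF that] D(1)] by simp
  then show ?thesis
    using bounded_opD[OF f] bounded_opD[OF g] unfolding bounded_op_def by auto
qed

lemma bounded_op_plus:
  assumes f: "bounded_op UNIV S f" and g: "bounded_op UNIV S' g"
  shows "bounded_op UNIV UNIV (\<lambda>x. f x + g x)"
proof -
  obtain C where C: "\<And>x. norm (f x) \<le> C * norm x"
    using bounded_op_bound[OF f] by (metis UNIV_I)
  obtain D where D: "\<And>x. norm (g x) \<le> D * norm x"
    using bounded_op_bound[OF g] by (metis UNIV_I)
  have "norm (f x + g x) \<le> (C + D) * norm x" for x
    unfolding distrib_right by (rule norm_triangle_le[OF add_mono[OF C D]])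
  then show ?thesis
    unfolding bounded_op_def
    by (auto simp: bounded_op_add[OF f] bounded_op_add[OF g] bounded_op_scaleC[OF f]
        bounded_op_scaleC[OF g] scaleC_add_right)
qed

lemma bounded_op_mono:
  "\<lbrakk>bounded_op S S' f; T \<subseteq> S; S' \<subseteq> T'\<rbrakk> \<Longrightarrow> bounded_op T T' f"
  unfolding bounded_op_def by (meson subset_iff)

text \<open>By continuity and linearity the points of \<open>ccspan X\<close> where two operators
  agree form a closed subspace. This carries identities from generators to closed spans.\<close>

lemma bounded_op_eq_on_ccspan:
  assumes f: "bounded_op (ccspan X) S' f" and g: "bounded_op (ccspan X) S'' g"
    and eq: "\<And>x. x \<in> X \<Longrightarrow> f x = g x" and x: "x \<in> ccspan X"
  shows "f x = g x"
proof -
  have "closed {x \<in> ccspan X. f x - g x = 0}"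
    by (intro continuous_closed_preimage_constant continuous_on_diff
        bounded_op_continuous_on[OF f] bounded_op_continuous_on[OF g]) auto
  moreover have "csubspace {x \<in> ccspan X. f x - g x = 0}"
  proof -
    have "0 \<in> ccspan X" by (simp add: csubspace_0)
    then show ?thesis
      unfolding csubspace_def[of "Collect _"]
      by (simp add: bounded_op_zero[OF f] bounded_op_zero[OF g] bounded_op_add[OF f]
          bounded_op_add[OF g] bounded_op_scaleC[OF f] bounded_op_scaleC[OF g]
          csubspace_add csubspace_scaleC)
  qed
  ultimately have "closed_csubspace {x \<in> ccspan X. f x - g x = 0}"
    by (simp add: closed_csubspace_def)
  then have "ccspan X \<subseteq> {x \<in> ccspan X. f x - g x = 0}"
    using eq ccspan_base by (intro ccspan_minimal) auto
  then show ?thesis using x by auto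
qed

text \<open>The same closure argument, one variable at a time: first in \<open>y\<close> with a
  generator \<open>x\<close> held fixed, then in \<open>x\<close>.\<close>

lemma adjoint_relation_ccspan:
  assumes f: "bounded_op (ccspan X) S' f" and g: "bounded_op (ccspan Y) S g"
    and XY: "\<And>x y. x \<in> X \<Longrightarrow> y \<in> Y \<Longrightarrow> cinner (f x) y = cinner x (g y)"
    and x: "x \<in> ccspan X" and y: "y \<in> ccspan Y"
  shows "cinner (f x) y = cinner x (g y)"
proof -
  have *: "cinner (f x) y = cinner x (g y)" if x: "x \<in> X" for x
  proof -
    have "closed {y \<in> ccspan Y. cinner (f x) y - cinner x (g y) = 0}"
      by (intro continuous_closed_preimage_constant continuous_intros
          bounded_op_continuous_on[OF g]) auto
    moreover have "0 \<in> ccspan Y" by (simp add: csubspace_0)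
    ultimately have "closed_csubspace {y \<in> ccspan Y. cinner (f x) y - cinner x (g y) = 0}"
      unfolding closed_csubspace_def csubspace_def[of "Collect _"]
      by (simp add: bounded_op_zero[OF g] bounded_op_add[OF g] bounded_op_scaleC[OF g]
          cinner_add_right cinner_scaleC_right csubspace_add csubspace_scaleC)
    then have "ccspan Y \<subseteq> {y \<in> ccspan Y. cinner (f x) y - cinner x (g y) = 0}"
      using XY[OF x] ccspan_base by (intro ccspan_minimal) auto
    then show ?thesis using y by auto
  qed
  have "closed {x \<in> ccspan X. cinner (f x) y - cinner x (g y) = 0}"
    by (intro continuous_closed_preimage_constant continuous_intros
        bounded_op_continuous_on[OF f]) auto
  moreover have "0 \<in> ccspan X" by (simp add: csubspace_0)
  ultimately have "closed_csubspace {x \<in> ccspan X. cinner (f x) y - cinner x (g y) = 0}"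
    unfolding closed_csubspace_def csubspace_def[of "Collect _"]
    by (simp add: bounded_op_zero[OF f] bounded_op_add[OF f] bounded_op_scaleC[OF f]
        cinner_add_left cinner_scaleC_left csubspace_add csubspace_scaleC)
  then have "ccspan X \<subseteq> {x \<in> ccspan X. cinner (f x) y - cinner x (g y) = 0}"
    using * ccspan_base by (intro ccspan_minimal) auto
  then show ?thesis using x by auto
qed

section \<open>Extension of operators from a total set\<close>

text \<open>Formal combinations are lists, so that sums become concatenations and repeated or
  linearly dependent vectors need no normal form.\<close>

definition lincomb :: "('b \<Rightarrow> 'a::complex_hilbert_space) \<Rightarrow> (complex \<times> 'b) list \<Rightarrow> 'a" where
  "lincomb u l = (\<Sum>(c, b)\<leftarrow>l. c *\<^sub>C u b)"

lemma lincomb_Nil [simp]: "lincomb u [] = 0"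
  and lincomb_Cons [simp]: "lincomb u ((c, b) # l) = c *\<^sub>C u b + lincomb u l"
  and lincomb_append [simp]: "lincomb u (l @ l') = lincomb u l + lincomb u l'"
  by (simp_all add: lincomb_def)

lemma lincomb_scale: "lincomb u (map (\<lambda>(c, b). (d * c, b)) l) = d *\<^sub>C lincomb u l"
  by (induction l) (auto simp: scaleC_add_right scaleC_scaleC)

lemma lincomb_in: "csubspace S \<Longrightarrow> (\<And>b. b \<in> snd ` set l \<Longrightarrow> u b \<in> S) \<Longrightarrow> lincomb u l \<in> S"
  by (induction l) (auto simp: csubspace_0 csubspace_add csubspace_scaleC)

text \<open>The graph of the extension is the closure of the graph on linear combinations.\<close>

theorem bounded_op_extension:
  fixes u :: "'b \<Rightarrow> 'x::complex_hilbert_space" and v :: "'b \<Rightarrow> 'y::complex_hilbert_space"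
  assumes bound: "\<And>l. snd ` set l \<subseteq> A \<Longrightarrow> norm (lincomb v l) \<le> C * norm (lincomb u l)"
  obtains F where "bounded_op (ccspan (u ` A)) (ccspan (v ` A)) F" "\<And>b. b \<in> A \<Longrightarrow> F (u b) = v b"
proof -
  define G where "G = closure ((\<lambda>l. (lincomb u l, lincomb v l)) ` {l. snd ` set l \<subseteq> A})"
  have G_seq: "\<exists>l. (\<forall>n. snd ` set (l n) \<subseteq> A) \<and> (\<lambda>n. lincomb u (l n)) \<longlonglongrightarrow> x
      \<and> (\<lambda>n. lincomb v (l n)) \<longlonglongrightarrow> y" if xy: "(x, y) \<in> G" for x y
  proof -
    obtain p where p: "\<And>n. p n \<in> (\<lambda>l. (lincomb u l, lincomb v l)) ` {l. snd ` set l \<subseteq> A}"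
      "p \<longlonglongrightarrow> (x, y)" using xy unfolding G_def closure_sequential by blast
    have "\<forall>n. \<exists>l. snd ` set l \<subseteq> A \<and> p n = (lincomb u l, lincomb v l)" using p(1) by blast
    then obtain l where "\<And>n. snd ` set (l n) \<subseteq> A"
      "\<And>n. p n = (lincomb u (l n), lincomb v (l n))" by metis
    then show ?thesis using tendsto_fst[OF p(2)] tendsto_snd[OF p(2)] by auto
  qed
  have G_I: "(x, y) \<in> G" if "\<And>n. snd ` set (l n) \<subseteq> A" "(\<lambda>n. lincomb u (l n)) \<longlonglongrightarrow> x"
      "(\<lambda>n. lincomb v (l n)) \<longlonglongrightarrow> y" for l x y
    unfolding G_def closure_sequential using that
    by (intro exI[of _ "\<lambda>n. (lincomb u (l n), lincomb v (l n))"]) (auto intro: tendsto_Pair)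
  have G_add: "(x + x', y + y') \<in> G" if xy: "(x, y) \<in> G" and xy': "(x', y') \<in> G" for x y x' y'
  proof -
    obtain l where l: "\<And>n. snd ` set (l n) \<subseteq> A" "(\<lambda>n. lincomb u (l n)) \<longlonglongrightarrow> x"
      "(\<lambda>n. lincomb v (l n)) \<longlonglongrightarrow> y" using G_seq[OF xy] by blast
    obtain l' where l': "\<And>n. snd ` set (l' n) \<subseteq> A" "(\<lambda>n. lincomb u (l' n)) \<longlonglongrightarrow> x'"
      "(\<lambda>n. lincomb v (l' n)) \<longlonglongrightarrow> y'" using G_seq[OF xy'] by blast
    show ?thesis
      by (rule G_I[of "\<lambda>n. l n @ l' n"])
         (use l l' in \<open>auto simp: image_Un intro!: tendsto_add\<close>)
  qed
  have G_scale: "(c *\<^sub>C x, c *\<^sub>C y) \<in> G" if xy: "(x, y) \<in> G" for c x y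
  proof -
    obtain l where l: "\<And>n. snd ` set (l n) \<subseteq> A" "(\<lambda>n. lincomb u (l n)) \<longlonglongrightarrow> x"
      "(\<lambda>n. lincomb v (l n)) \<longlonglongrightarrow> y" using G_seq[OF xy] by blast
    show ?thesis
    proof (rule G_I[of "\<lambda>n. map (\<lambda>(d, b). (c * d, b)) (l n)"])
      show "snd ` set (map (\<lambda>(d, b). (c * d, b)) (l n)) \<subseteq> A" for n
        using l(1)[of n] by (auto simp: image_subset_iff)
    qed (unfold lincomb_scale, (rule bounded_linear.tendsto[OF bounded_linear_scaleC] l)+)
  qed
  \<comment> \<open>The estimate passes to limits and so holds on the whole closed graph. Applied to
    differences it makes the graph single-valued and its domain closed.\<close>
  have G_bound: "norm y \<le> C * norm x" if xy: "(x, y) \<in> G" for x y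
  proof -
    obtain l where l: "\<And>n. snd ` set (l n) \<subseteq> A" "(\<lambda>n. lincomb u (l n)) \<longlonglongrightarrow> x"
      "(\<lambda>n. lincomb v (l n)) \<longlonglongrightarrow> y" using G_seq[OF xy] by blast
    have "(\<lambda>n. C * norm (lincomb u (l n))) \<longlonglongrightarrow> C * norm x"
      by (intro tendsto_intros l)
    with tendsto_norm[OF l(3)] show ?thesis
      using bound[OF l(1)] by (intro LIMSEQ_le) auto
  qed
  have G_diff: "(x - x', y - y') \<in> G" if "(x, y) \<in> G" "(x', y') \<in> G" for x y x' y'
    using G_add[OF that(1) G_scale[OF that(2), of "-1"]] by (simp add: scaleC_minus_one)
  have G_base: "(u b, v b) \<in> G" if "b \<in> A" for b
    by (rule G_I[of "\<lambda>_. [(1, b)]"]) (use that in auto)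
  have G_unique: "y = y'" if "(x, y) \<in> G" "(x, y') \<in> G" for x y y'
    using G_bound[OF G_diff[OF that]] by simp
  \<comment> \<open>If the first coordinates converge, the bound makes the second ones Cauchy, and
    the limit pair lies in the closed set \<open>G\<close>.\<close>
  have "closed {x. \<exists>y. (x, y) \<in> G}"
    unfolding closed_sequential_limits
  proof safe
    fix s x assume "\<forall>n. s n \<in> {x. \<exists>y. (x, y) \<in> G}" and sx: "s \<longlonglongrightarrow> x"
    then have "\<forall>n. \<exists>y. (s n, y) \<in> G" by simp
    then obtain t where t: "\<And>n. (s n, t n) \<in> G" by metis
    have "Cauchy t"
    proof (rule CauchyI)
      fix e :: real assume e: "0 < e"
      have "Cauchy s" using sx by (rule LIMSEQ_imp_Cauchy)
      \<comment> \<open>The sign of \<open>C\<close> is not known, so the divisor is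
        \<open>\<bar>C\<bar> + 1\<close>, which is positive and at least \<open>C\<close>.\<close>
      moreover have "0 < e / (\<bar>C\<bar> + 1)" using e by (simp add: add_nonneg_pos)
      ultimately obtain M where M: "\<forall>m\<ge>M. \<forall>n\<ge>M. norm (s m - s n) < e / (\<bar>C\<bar> + 1)"
        using CauchyD by blast
      have "norm (t m - t n) < e" if "M \<le> m" "M \<le> n" for m n
      proof -
        have "norm (t m - t n) \<le> C * norm (s m - s n)" using G_bound[OF G_diff[OF t t]] .
        also have "\<dots> \<le> (\<bar>C\<bar> + 1) * norm (s m - s n)" by (intro mult_right_mono) auto
        also have "\<dots> < e" using M that by (simp add: pos_less_divide_eq mult.commute add_nonneg_pos)
        finally show ?thesis .
      qed
      then show "\<exists>M. \<forall>m\<ge>M. \<forall>n\<ge>M. norm (t m - t n) < e" by blast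
    qed
    then obtain y where "t \<longlonglongrightarrow> y" using Cauchy_convergent convergent_def by blast
    then have "(\<lambda>n. (s n, t n)) \<longlonglongrightarrow> (x, y)" using sx by (rule tendsto_Pair[rotated])
    moreover have "closed G" by (simp add: G_def)
    ultimately have "(x, y) \<in> G" using t by (rule closed_sequentially[rotated 2])
    then show "\<exists>y. (x, y) \<in> G" ..
  qed
  moreover have "csubspace {x. \<exists>y. (x, y) \<in> G}"
  proof -
    have "(0, 0) \<in> G" by (rule G_I[of "\<lambda>_. []"]) auto
    then show ?thesis unfolding csubspace_def using G_add G_scale by blast
  qed
  ultimately have dom: "\<exists>y. (x, y) \<in> G" if "x \<in> ccspan (u ` A)" for x
    using that ccspan_minimal[of "u ` A" "{x. \<exists>y. (x, y) \<in> G}"] G_base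
    unfolding closed_csubspace_def by blast
  have ran: "y \<in> ccspan (v ` A)" if xy: "(x, y) \<in> G" for x y
  proof -
    obtain l where l: "\<And>n. snd ` set (l n) \<subseteq> A" "(\<lambda>n. lincomb v (l n)) \<longlonglongrightarrow> y"
      using G_seq[OF xy] by blast
    have "lincomb v (l n) \<in> ccspan (v ` A)" for n
      using l(1)[of n] by (intro lincomb_in) (auto intro: ccspan_base)
    then show ?thesis using closed_sequentially[OF closed_ccspan _ l(2)] by blast
  qed
  define F where "F x = (SOME y. (x, y) \<in> G)" for x
  have F: "(x, F x) \<in> G" if "x \<in> ccspan (u ` A)" for x
    unfolding F_def using dom[OF that] by (rule someI_ex)
  have F_eq: "F x = y" if "(x, y) \<in> G" for x y
    unfolding F_def using that G_unique by (blast intro: some_equality)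
  have "bounded_op (ccspan (u ` A)) (ccspan (v ` A)) F"
    unfolding bounded_op_def
    by (intro conjI ballI allI exI[of _ C])
       (simp_all add: ran[OF F] F_eq[OF G_add[OF F F]] F_eq[OF G_scale[OF F]] G_bound[OF F])
  then show thesis using that F_eq[OF G_base] by blast
qed

text \<open>Equal Gram matrices make \<open>u b \<mapsto> v b\<close> isometric on combinations, so
  it extends to the closed spans, and so does its inverse. Each extension is preceded by the
  orthogonal projection onto its domain; this makes \<open>F\<close> vanish on the orthogonal
  complement of the \<open>u b\<close> and makes \<open>G\<close> the adjoint of
  \<open>F\<close>.\<close>

theorem partial_isometry_extension:
  fixes u :: "'b \<Rightarrow> 'x::complex_hilbert_space" and v :: "'b \<Rightarrow> 'y::complex_hilbert_space"
  assumes gram: "\<And>a b. a \<in> A \<Longrightarrow> b \<in> A \<Longrightarrow> cinner (v a) (v b) = cinner (u a) (u b)"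
  obtains F G where "bounded_op UNIV (ccspan (v ` A)) F" "bounded_op UNIV (ccspan (u ` A)) G"
    "\<And>b. b \<in> A \<Longrightarrow> F (u b) = v b"
    "\<And>x. (\<And>b. b \<in> A \<Longrightarrow> cinner x (u b) = 0) \<Longrightarrow> F x = 0"
    "\<And>x y. cinner (F x) y = cinner x (G y)"
proof -
  let ?M = "ccspan (u ` A)" and ?N = "ccspan (v ` A)"
  have cinner_lincomb: "cinner (lincomb w l) (lincomb w l')
      = (\<Sum>(c, a)\<leftarrow>l. \<Sum>(d, b)\<leftarrow>l'. c * cnj d * cinner (w a) (w b))"
    for w :: "'b \<Rightarrow> 'z::complex_hilbert_space" and l l'
    unfolding lincomb_def cinner_sum_list_left
    by (simp add: split_def cinner_sum_list_right cinner_scaleC_left cinner_scaleC_right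
        mult.assoc mult.left_commute)
  have norm_eq: "norm (lincomb v l) = norm (lincomb u l)" if l: "snd ` set l \<subseteq> A" for l
  proof -
    have "b \<in> A" if "(c, b) \<in> set l" for c b using l that by force
    then have *: "cinner (v a) (v b) = cinner (u a) (u b)"
      if "(c, a) \<in> set l" "(d, b) \<in> set l" for c a d b
      using that gram by blast
    have "cinner (lincomb v l) (lincomb v l) = cinner (lincomb u l) (lincomb u l)"
      unfolding cinner_lincomb
      using * by (auto intro!: arg_cong[where f = sum_list] map_cong)
    then show ?thesis by (simp add: cinner_self flip: of_real_power)
  qed
  obtain F where F: "bounded_op ?M ?N F" "\<And>b. b \<in> A \<Longrightarrow> F (u b) = v b"
    using bounded_op_extension[of A v 1 u, unfolded mult_1, OF eq_refl[OF norm_eq]] by blast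
  obtain G where G: "bounded_op ?N ?M G" "\<And>b. b \<in> A \<Longrightarrow> G (v b) = u b"
    using bounded_op_extension[of A u 1 v, unfolded mult_1, OF eq_refl[OF norm_eq[symmetric]]]
    by blast
  have adj: "cinner (F x) y = cinner x (G y)" if "x \<in> ?M" "y \<in> ?N" for x y
    by (rule adjoint_relation_ccspan[OF F(1) G(1) _ that]) (auto simp: F G gram)
  let ?P = "orth_proj ?M" and ?Q = "orth_proj ?N"
  note P = bounded_op_orth_proj[OF closed_csubspace_ccspan[of "u ` A"]]
    orth_proj[OF closed_csubspace_ccspan[of "u ` A"]]
  note Q = bounded_op_orth_proj[OF closed_csubspace_ccspan[of "v ` A"]]
    orth_proj[OF closed_csubspace_ccspan[of "v ` A"]]
  show thesis
  proof (rule that[of "\<lambda>x. F (?P x)" "\<lambda>y. G (?Q y)"])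
    show "bounded_op UNIV ?N (\<lambda>x. F (?P x))" by (rule bounded_op_compose[OF P(1) F(1)])
    show "bounded_op UNIV ?M (\<lambda>y. G (?Q y))" by (rule bounded_op_compose[OF Q(1) G(1)])
    show "F (?P (u b)) = v b" if "b \<in> A" for b
      using that F(2) orth_proj_eqI[of ?M "u b" "u b"] ccspan_base[of "u b" "u ` A"] by simp
    show "F (?P x) = 0" if "\<And>b. b \<in> A \<Longrightarrow> cinner x (u b) = 0" for x
    proof -
      have "?P x = 0"
        using orthogonal_ccspan[of "u ` A" x] that by (intro orth_proj_eqI) (auto simp: csubspace_0)
      then show ?thesis using bounded_op_zero[OF F(1)] by simp
    qed
    show "cinner (F (?P x)) y = cinner x (G (?Q y))" for x y
    proof -
      \<comment> \<open>\<open>F (?P x)\<close> lies in the closed span of the \<open>v b\<close>,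
        to which the part of \<open>y\<close> removed by \<open>?Q\<close> is orthogonal.\<close>
      have "cinner (F (?P x)) y = cinner (F (?P x)) (?Q y)"
        using Q(3)[OF bounded_op_in[OF F(1) P(2)], of y x]
        by (simp add: cinner_diff_right cinner_eq_zero_commute[of "y - _"])
      also have "\<dots> = cinner (?P x) (G (?Q y))" by (rule adj[OF P(2) Q(2)])
      also have "\<dots> = cinner x (G (?Q y))"
        using P(3)[OF bounded_op_in[OF G(1) Q(2)], of x y] by (simp add: cinner_diff_left)
      finally show ?thesis .
    qed
  qed
qed

section \<open>Tensor products\<close>

lemma hilbert_tensorD:
  assumes "hilbert_tensor S S' \<tau>"
  shows hilbert_tensor_add_left:
      "x \<in> S \<Longrightarrow> x' \<in> S \<Longrightarrow> y \<in> S' \<Longrightarrow> \<tau> (x + x') y = \<tau> x y + \<tau> x' y"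
    and hilbert_tensor_add_right:
      "x \<in> S \<Longrightarrow> y \<in> S' \<Longrightarrow> y' \<in> S' \<Longrightarrow> \<tau> x (y + y') = \<tau> x y + \<tau> x y'"
    and hilbert_tensor_scaleC_left: "x \<in> S \<Longrightarrow> y \<in> S' \<Longrightarrow> \<tau> (c *\<^sub>C x) y = c *\<^sub>C \<tau> x y"
    and hilbert_tensor_scaleC_right: "x \<in> S \<Longrightarrow> y \<in> S' \<Longrightarrow> \<tau> x (c *\<^sub>C y) = c *\<^sub>C \<tau> x y"
    and hilbert_tensor_cinner: "x \<in> S \<Longrightarrow> x' \<in> S \<Longrightarrow> y \<in> S' \<Longrightarrow> y' \<in> S' \<Longrightarrow>
      cinner (\<tau> x y) (\<tau> x' y') = cinner x x' * cinner y y'"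
  using assms unfolding hilbert_tensor_def by blast+

lemma hilbert_tensor_norm:
  assumes "hilbert_tensor S S' \<tau>" "x \<in> S" "y \<in> S'"
  shows "norm (\<tau> x y) = norm x * norm y"
proof -
  have "complex_of_real ((norm (\<tau> x y))\<^sup>2) = complex_of_real ((norm x * norm y)\<^sup>2)"
    using hilbert_tensor_cinner[OF assms(1,2,2,3,3)] by (simp add: cinner_self power_mult_distrib)
  then have "(norm (\<tau> x y))\<^sup>2 = (norm x * norm y)\<^sup>2" using of_real_eq_iff by blast
  then show ?thesis by (simp add: power2_eq_iff_nonneg)
qed

lemma bounded_op_hilbert_tensor_right:
  assumes \<tau>: "hilbert_tensor S S' \<tau>" and x: "x \<in> S"
  shows "bounded_op S' UNIV (\<tau> x)"
  unfolding bounded_op_def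
  using hilbert_tensor_add_right[OF \<tau> x] hilbert_tensor_scaleC_right[OF \<tau> x]
    hilbert_tensor_norm[OF \<tau> x] by fastforce

text \<open>An entry that occurs twice in such a list is orthogonal to itself, hence zero, so
  repetitions do not disturb the Fourier formula.\<close>

lemma cinner_orthogonal_combination:
  fixes es :: "'a::complex_hilbert_space list"
  assumes "sorted_wrt (\<lambda>x y. cinner x y = 0) es" "e \<in> set es"
  shows "cinner (\<Sum>d\<leftarrow>es. c d *\<^sub>C d) e = c e * cinner e e"
  using assms
proof (induction es)
  case (Cons d es)
  show ?case
  proof (cases "e \<in> set es")
    case True
    then show ?thesis using Cons by (simp add: cinner_add_left cinner_scaleC_left)
  next
    case False
    then have [simp]: "e = d" using Cons by simp
    have "(\<Sum>b\<leftarrow>es. c b * cinner b d) = (\<Sum>b\<leftarrow>es. 0)"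
      using Cons.prems by (intro arg_cong[where f = sum_list] map_cong)
        (auto simp: cinner_eq_zero_commute)
    then show ?thesis
      by (simp add: cinner_add_left cinner_scaleC_left cinner_sum_list_left)
  qed
qed simp

text \<open>
  Gram-Schmidt in the second factor, without normalization: zero vectors may occur, and their
  Fourier coefficients are \<open>0 / 0 = 0\<close>. The new representation serves all operators \<open>T\<close> at once.
\<close>

lemma tensor_orthogonalization:
  assumes \<tau>: "hilbert_tensor S S' \<tau>" and S: "csubspace S" and S': "csubspace S'"
    and l: "set l \<subseteq> S \<times> S'"
  obtains l' where "set l' \<subseteq> S \<times> S'" "sorted_wrt (\<lambda>x y. cinner x y = 0) (map snd l')"
    "\<And>T. bounded_op S S T \<Longrightarrow> (\<Sum>(x, y)\<leftarrow>l. \<tau> (T x) y) = (\<Sum>(x, y)\<leftarrow>l'. \<tau> (T x) y)"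
  using l
proof (induction l arbitrary: thesis)
  case Nil
  show ?case by (rule Nil.prems(1)[of "[]"]) auto
next
  case (Cons p l)
  obtain x y where p: "p = (x, y)" by fastforce
  then have x: "x \<in> S" and y: "y \<in> S'" using Cons.prems(2) by auto
  obtain l' where l': "set l' \<subseteq> S \<times> S'" "sorted_wrt (\<lambda>x y. cinner x y = 0) (map snd l')"
    "\<And>T. bounded_op S S T \<Longrightarrow> (\<Sum>(x, y)\<leftarrow>l. \<tau> (T x) y) = (\<Sum>(x, y)\<leftarrow>l'. \<tau> (T x) y)"
    using Cons.IH Cons.prems(2) by auto
  define c where "c e = cinner y e / cinner e e" for e
  define r where "r = y - (\<Sum>e\<leftarrow>map snd l'. c e *\<^sub>C e)"
  \<comment> \<open>The tensor of \<open>x\<close> and \<open>y\<close> is split along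
    \<open>y = r +\<close> the combination of the \<open>e\<close>. The part along \<open>e\<close>
    is absorbed into the first factor of the tensor that already has second factor \<open>e\<close>;
    only \<open>r\<close> starts a new tensor.\<close>
  define l'' where "l'' = map (\<lambda>(x', e). (x' + c e *\<^sub>C x, e)) l'"
  have comb: "(\<Sum>e\<leftarrow>map snd l'. c e *\<^sub>C e) \<in> S'"
    using l'(1) by (intro csubspace_sum_list[OF S']) (auto intro!: csubspace_scaleC[OF S'])
  have r: "r \<in> S'" unfolding r_def using S' y comb by (rule csubspace_diff)
  have r_orth: "cinner r e = 0" if "e \<in> set (map snd l')" for e
    using cinner_orthogonal_combination[OF l'(2) that, of c]
    by (simp add: r_def cinner_diff_left c_def)
  have snd_l'': "map snd l'' = map snd l'" by (simp add: l''_def case_prod_beta)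
  show ?case
  proof (rule Cons.prems(1)[of "(x, r) # l''"])
    show "set ((x, r) # l'') \<subseteq> S \<times> S'"
      using l'(1) x r by (auto simp: l''_def intro!: csubspace_add[OF S] csubspace_scaleC[OF S])
    show "sorted_wrt (\<lambda>x y. cinner x y = 0) (map snd ((x, r) # l''))"
      using l'(2) r_orth unfolding list.map(2) snd_l'' by simp
    fix T assume T: "bounded_op S S T"
    note Tx = bounded_op_in[OF T x]
    have "(\<Sum>(x', e)\<leftarrow>l''. \<tau> (T x') e)
        = (\<Sum>(x', e)\<leftarrow>l'. \<tau> (T x') e + c e *\<^sub>C \<tau> (T x) e)"
      unfolding l''_def map_map comp_def
    proof (intro arg_cong[where f = sum_list] map_cong refl)
      fix q assume "q \<in> set l'"
      then obtain x' e where q: "q = (x', e)" and x': "x' \<in> S" and e: "e \<in> S'" using l'(1) by auto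
      have "T (x' + c e *\<^sub>C x) = T x' + c e *\<^sub>C T x"
        using x x' bounded_op_add[OF T] bounded_op_scaleC[OF T] csubspace_scaleC[OF S] by simp
      then show "(case case q of (x', e) \<Rightarrow> (x' + c e *\<^sub>C x, e) of (x', e) \<Rightarrow> \<tau> (T x') e)
          = (case q of (x', e) \<Rightarrow> \<tau> (T x') e + c e *\<^sub>C \<tau> (T x) e)"
        using x' e Tx bounded_op_in[OF T x'] csubspace_scaleC[OF S Tx]
        by (simp add: q hilbert_tensor_add_left[OF \<tau>] hilbert_tensor_scaleC_left[OF \<tau>])
    qed
    also have "\<dots> = (\<Sum>(x', e)\<leftarrow>l'. \<tau> (T x') e) + (\<Sum>(x', e)\<leftarrow>l'. c e *\<^sub>C \<tau> (T x) e)"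
      by (simp add: split_def sum_list_addf)
    also have "(\<Sum>(x', e)\<leftarrow>l'. c e *\<^sub>C \<tau> (T x) e) = (\<Sum>e\<leftarrow>map snd l'. \<tau> (T x) (c e *\<^sub>C e))"
      unfolding map_map comp_def using l'(1)
      by (intro arg_cong[where f = sum_list] map_cong refl)
         (auto simp: hilbert_tensor_scaleC_right[OF \<tau> Tx])
    also have "\<dots> = \<tau> (T x) (\<Sum>e\<leftarrow>map snd l'. c e *\<^sub>C e)"
      using l'(1)
      by (intro bounded_op_sum_list[OF bounded_op_hilbert_tensor_right[OF \<tau> Tx] S', symmetric])
         (auto intro!: csubspace_scaleC[OF S'])
    also have "\<dots> = \<tau> (T x) y - \<tau> (T x) r"
      using hilbert_tensor_add_right[OF \<tau> Tx r comb] by (simp add: r_def)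
    finally show "(\<Sum>(x, y)\<leftarrow>p # l. \<tau> (T x) y) = (\<Sum>(x, y)\<leftarrow>(x, r) # l''. \<tau> (T x) y)"
      using l'(3)[OF T] by (simp add: p)
  qed
qed

text \<open>Orthogonal second factors make the elementary tensors orthogonal whatever
  \<open>T\<close> does to the first factors, so Pythagoras applies.\<close>

lemma norm_orthogonal_tensor_sum:
  assumes \<tau>: "hilbert_tensor S S' \<tau>"
    and "set l \<subseteq> S \<times> S'" "sorted_wrt (\<lambda>x y. cinner x y = 0) (map snd l)"
    and T: "bounded_op S S T"
  shows "(norm (\<Sum>(x, y)\<leftarrow>l. \<tau> (T x) y))\<^sup>2 = (\<Sum>(x, y)\<leftarrow>l. (norm (T x))\<^sup>2 * (norm y)\<^sup>2)"
  using assms(2,3)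
proof (induction l)
  case (Cons p l)
  obtain x y where p: "p = (x, y)" by fastforce
  note Tin = bounded_op_in[OF T]
  have "cinner (\<tau> (T x) y) (\<tau> (T x') y') = 0" if q: "(x', y') \<in> set l" for x' y'
  proof -
    have "x \<in> S" "y \<in> S'" "x' \<in> S" "y' \<in> S'" using q Cons.prems(1) by (auto simp: p)
    moreover have "cinner y y' = 0" using q Cons.prems(2) by (auto simp: p)
    ultimately show ?thesis by (simp add: hilbert_tensor_cinner[OF \<tau>] Tin)
  qed
  then have "(\<Sum>(x', y')\<leftarrow>l. cinner (\<tau> (T x) y) (\<tau> (T x') y')) = (\<Sum>(x', y')\<leftarrow>l. 0)"
    by (intro arg_cong[where f = sum_list] map_cong refl) auto
  then have "cinner (\<tau> (T x) y) (\<Sum>(x, y)\<leftarrow>l. \<tau> (T x) y) = 0"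
    by (simp add: cinner_sum_list_right split_def)
  then show ?case using Cons hilbert_tensor_norm[OF \<tau>] Tin
    by (auto simp: p norm_add_square power_mult_distrib)
qed simp

text \<open>Once the second factors are orthogonal, the squared norm is a sum of terms
  \<open>(norm (T x))\<^sup>2 * (norm y)\<^sup>2\<close>, so a bound \<open>C\<close> for
  \<open>T\<close> bounds the map on sums of elementary tensors with the same constant. The
  extension from a total set does the rest.\<close>

theorem bounded_op_tensor_id:
  assumes \<tau>: "hilbert_tensor S S' \<tau>" and S: "csubspace S" and S': "csubspace S'"
    and T: "bounded_op S S T"
  defines "N \<equiv> ccspan {\<tau> x y | x y. x \<in> S \<and> y \<in> S'}"
  obtains R where "bounded_op N N R" "\<And>x y. x \<in> S \<Longrightarrow> y \<in> S' \<Longrightarrow> R (\<tau> x y) = \<tau> (T x) y"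
proof -
  obtain C where C: "0 \<le> C" "\<And>x. x \<in> S \<Longrightarrow> norm (T x) \<le> C * norm x"
    using bounded_op_bound[OF T] by blast
  define u where "u = (\<lambda>(x, y). \<tau> x y)"
  define v where "v = (\<lambda>(x, y). \<tau> (T x) y)"
  \<comment> \<open>The orthogonalized list represents the sum for every bounded operator on
    \<open>S\<close>. With the identity in place of \<open>T\<close> it represents the argument
    itself, so both norms can be compared term by term.\<close>
  have id: "bounded_op S S (\<lambda>x. x)" unfolding bounded_op_def by (auto intro: exI[of _ 1])
  have bound: "norm (lincomb v l) \<le> C * norm (lincomb u l)" if l: "snd ` set l \<subseteq> S \<times> S'" for l
  proof -
    \<comment> \<open>Coefficients move into the first factor, since the orthogonalization deals
      with plain sums of elementary tensors.\<close>
    define m where "m = map (\<lambda>(c, x, y). (c *\<^sub>C x, y)) l"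
    have l_in: "x \<in> S \<and> y \<in> S'" if "(c, x, y) \<in> set l" for c x y
      using l that by force
    then have m: "set m \<subseteq> S \<times> S'"
      by (auto simp: m_def intro!: csubspace_scaleC[OF S])
    have lin: "(\<Sum>(c, x, y)\<leftarrow>l. c *\<^sub>C \<tau> (T' x) y) = (\<Sum>(x, y)\<leftarrow>m. \<tau> (T' x) y)"
      if T': "bounded_op S S T'" for T'
      unfolding m_def map_map comp_def
    proof (intro arg_cong[where f = sum_list] map_cong refl)
      fix q assume ql: "q \<in> set l"
      obtain c x y where q: "q = (c, x, y)" by (metis prod_cases3)
      have xy: "x \<in> S" "y \<in> S'" using l_in[of c x y] ql q by simp_all
      show "(case q of (c, x, y) \<Rightarrow> c *\<^sub>C \<tau> (T' x) y)
          = (case case q of (c, x, y) \<Rightarrow> (c *\<^sub>C x, y) of (x, y) \<Rightarrow> \<tau> (T' x) y)"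
        by (simp add: q bounded_op_scaleC[OF T' xy(1)]
            hilbert_tensor_scaleC_left[OF \<tau> bounded_op_in[OF T' xy(1)] xy(2)])
    qed
    obtain m' where m': "set m' \<subseteq> S \<times> S'" "sorted_wrt (\<lambda>x y. cinner x y = 0) (map snd m')"
      "\<And>T. bounded_op S S T \<Longrightarrow> (\<Sum>(x, y)\<leftarrow>m. \<tau> (T x) y) = (\<Sum>(x, y)\<leftarrow>m'. \<tau> (T x) y)"
      by (rule tensor_orthogonalization[OF \<tau> S S' m]) (rule that)
    have v_eq: "lincomb v l = (\<Sum>(x, y)\<leftarrow>m'. \<tau> (T x) y)"
      using lin[OF T] m'(3)[OF T] by (simp add: lincomb_def v_def split_def)
    have u_eq: "lincomb u l = (\<Sum>(x, y)\<leftarrow>m'. \<tau> x y)"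
      using lin[OF id] m'(3)[OF id] by (simp add: lincomb_def u_def split_def)
    have "(norm (lincomb v l))\<^sup>2 = (\<Sum>(x, y)\<leftarrow>m'. (norm (T x))\<^sup>2 * (norm y)\<^sup>2)"
      unfolding v_eq by (rule norm_orthogonal_tensor_sum[OF \<tau> m'(1,2) T])
    also have "\<dots> \<le> (\<Sum>(x, y)\<leftarrow>m'. C\<^sup>2 * ((norm x)\<^sup>2 * (norm y)\<^sup>2))"
    proof (rule sum_list_mono)
      fix q assume "q \<in> set m'"
      then obtain x y where q: "q = (x, y)" and x: "x \<in> S" using m'(1) by auto
      have "(norm (T x))\<^sup>2 * (norm y)\<^sup>2 \<le> (C * norm x)\<^sup>2 * (norm y)\<^sup>2"
        using C(2)[OF x] by (intro mult_right_mono power_mono) auto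
      then show "(case q of (x, y) \<Rightarrow> (norm (T x))\<^sup>2 * (norm y)\<^sup>2)
          \<le> (case q of (x, y) \<Rightarrow> C\<^sup>2 * ((norm x)\<^sup>2 * (norm y)\<^sup>2))"
        by (simp add: q power_mult_distrib mult.assoc)
    qed
    also have "\<dots> = C\<^sup>2 * (norm (lincomb u l))\<^sup>2"
      unfolding u_eq norm_orthogonal_tensor_sum[OF \<tau> m'(1,2) id]
      by (simp add: sum_list_const_mult split_def)
    finally have "(norm (lincomb v l))\<^sup>2 \<le> (C * norm (lincomb u l))\<^sup>2"
      unfolding power_mult_distrib .
    then show ?thesis by (rule power2_le_imp_le) (simp add: C(1))
  qed
  have u_img: "ccspan (u ` (S \<times> S')) = N"
    unfolding N_def by (rule arg_cong[where f = ccspan]) (auto simp: u_def)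
  have "v (x, y) \<in> N" if "x \<in> S" "y \<in> S'" for x y
    unfolding N_def v_def using bounded_op_in[OF T that(1)] that(2) by (intro ccspan_base) auto
  then have v_img: "ccspan (v ` (S \<times> S')) \<subseteq> N"
    unfolding N_def by (intro ccspan_minimal closed_csubspace_ccspan) auto
  obtain R where R: "bounded_op N (ccspan (v ` (S \<times> S'))) R"
    "\<And>q. q \<in> S \<times> S' \<Longrightarrow> R (u q) = v q"
    by (rule bounded_op_extension[of "S \<times> S'" v C u, unfolded u_img, OF bound]) (assumption, rule that)
  show thesis
  proof (rule that[OF bounded_op_mono[OF R(1) order_refl v_img]])
    show "R (\<tau> x y) = \<tau> (T x) y" if "x \<in> S" "y \<in> S'" for x y
      using R(2)[of "(x, y)"] that by (simp add: u_def v_def)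
  qed
qed

section \<open>The monotone product\<close>

lemma mono_words_Nil [simp]: "[] \<in> mono_words H xi"
  by (simp add: mono_words_def)

lemma mono_words_Cons:
  "(i, f) # w \<in> mono_words H xi \<longleftrightarrow>
    f \<in> ominus H xi i \<and> w \<in> mono_words H xi \<and> (w = [] \<or> fst (hd w) < i)"
  by (cases w) (auto simp: mono_words_def)

text \<open>The cases are the branches in the definition of \<open>V k\<close>; the empty word
  counts as \<open>below\<close>, since the vacuum is treated like a word that starts under
  \<open>k\<close>.\<close>

lemma mono_words_cases [consumes 1, case_names below equal above]:
  assumes "w \<in> mono_words H xi"
    and "w = [] \<or> fst (hd w) < k \<Longrightarrow> thesis"
    and "\<And>f w'. w = (k, f) # w' \<Longrightarrow> f \<in> ominus H xi k \<Longrightarrow> w' \<in> mono_words H xi \<Longrightarrow>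
      w' = [] \<or> fst (hd w') < k \<Longrightarrow> thesis"
    and "\<And>i f w'. w = (i, f) # w' \<Longrightarrow> k < i \<Longrightarrow> thesis"
  shows thesis
proof (cases w)
  case Nil
  then show thesis using assms(2) by simp
next
  case (Cons p w')
  obtain i f where p: "p = (i, f)" by fastforce
  consider "i < k" | "i = k" | "k < i" by fastforce
  then show thesis
  proof cases
    case 1
    then show thesis using assms(2) Cons p by simp
  next
    case 2
    then show thesis using assms(1) assms(3)[of f w'] Cons p by (simp add: mono_words_Cons)
  next
    case 3
    then show thesis using assms(4) Cons p by simp
  qed
qed

context monotone_product
begin

abbreviation words :: "('i \<times> 'h) list set" where
  "words \<equiv> mono_words H xi"

abbreviation below :: "'i \<Rightarrow> 'm set" where
  "below \<equiv> mono_below H xi elt"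

lemma csubspace_H: "csubspace (H k)"
  using H_closed by (simp add: closed_csubspace_def)

lemma closed_csubspace_below: "closed_csubspace (below k)"
  by (simp add: mono_below_def closed_csubspace_ccspan)

lemma csubspace_below: "csubspace (below k)"
  using closed_csubspace_below by (simp add: closed_csubspace_def)

lemma elt_in_below: "w \<in> words \<Longrightarrow> w = [] \<or> fst (hd w) < k \<Longrightarrow> elt w \<in> below k"
  unfolding mono_below_def by (intro ccspan_base) auto

lemma vacuum_in_below: "vacuum \<in> below k"
  unfolding vacuum_def by (rule elt_in_below) auto

lemma cinner_xi_xi: "cinner (xi k) (xi k) = 1"
  by (simp add: cinner_self xi_norm)

lemma elt_orthogonal:
  "w \<in> words \<Longrightarrow> w' \<in> words \<Longrightarrow> map fst w \<noteq> map fst w' \<Longrightarrow> cinner (elt w) (elt w') = 0"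
  by (simp add: elt_cinner)

lemma cinner_elt_Cons:
  assumes "(i, f) # w \<in> words" "(i, g) # w' \<in> words"
  shows "cinner (elt ((i, f) # w)) (elt ((i, g) # w')) = cinner f g * cinner (elt w) (elt w')"
proof -
  have "w \<in> words" "w' \<in> words" using assms by (auto simp: mono_words_Cons)
  then show ?thesis using assms
    by (simp add: elt_cinner prod.lessThan_Suc_shift del: prod.lessThan_Suc)
qed

lemma cinner_vacuum_vacuum: "cinner vacuum vacuum = 1"
  by (simp add: vacuum_def elt_cinner)

text \<open>A word generating \<open>below k\<close> is empty or starts under \<open>k\<close>, so
  it lies in another summand than \<open>w\<close>; orthogonality then passes to the closed
  span.\<close>

lemma below_elt_orthogonal:
  assumes x: "x \<in> below k" and w: "w \<in> words" "w \<noteq> []" "k \<le> fst (hd w)"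
  shows "cinner x (elt w) = 0"
proof -
  have "cinner (elt w) x = 0"
    using x unfolding mono_below_def
  proof (rule orthogonal_ccspan[rotated])
    fix z assume "z \<in> elt ` {w \<in> words. w = [] \<or> fst (hd w) < k}"
    then obtain w' where w': "z = elt w'" "w' \<in> words" "w' = [] \<or> fst (hd w') < k" by blast
    have "map fst w \<noteq> map fst w'"
      using w w'(3) by (cases w; cases w') auto
    then show "cinner (elt w) z = 0" using w w' elt_orthogonal by simp
  qed
  then show ?thesis using cinner_eq_zero_commute by blast
qed

section \<open>The partial isometries \<open>V k\<close>\<close>

definition V_word :: "'i \<Rightarrow> ('i \<times> 'h) list \<Rightarrow> 'k" where
  "V_word k w =
    (if w = [] \<or> fst (hd w) < k then tens k (xi k) (elt w) else tens k (snd (hd w)) (elt (tl w)))"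

lemma V_word_below: "w = [] \<or> fst (hd w) < k \<Longrightarrow> V_word k w = tens k (xi k) (elt w)"
  by (simp add: V_word_def)

lemma V_word_Cons: "V_word k ((k, f) # w) = tens k f (elt w)"
  by (simp add: V_word_def)

lemma cinner_tens:
  "\<lbrakk>x \<in> H k; x' \<in> H k; y \<in> below k; y' \<in> below k\<rbrakk> \<Longrightarrow>
    cinner (tens k x y) (tens k x' y') = cinner x x' * cinner y y'"
  by (rule hilbert_tensor_cinner[OF tens_tensor])

text \<open>\<open>V_word k\<close> gives the values that \<open>V k\<close> must take on words with
  leading index at most \<open>k\<close>. For two words of the same kind the inner product
  factorizes, with \<open>cinner (xi k) (xi k) = 1\<close> if both are below \<open>k\<close>. For a
  mixed pair both sides vanish: on the left because letters are orthogonal to \<open>xi k\<close>,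
  on the right because the summands differ.\<close>

lemma V_word_gram:
  assumes w: "w \<in> words" "w = [] \<or> fst (hd w) \<le> k"
    and w': "w' \<in> words" "w' = [] \<or> fst (hd w') \<le> k"
  shows "cinner (V_word k w) (V_word k w') = cinner (elt w) (elt w')"
  using w(1)
proof (cases rule: mono_words_cases[where k = k])
  case below: below
  show ?thesis using w'(1)
  proof (cases rule: mono_words_cases[where k = k])
    case below': below
    show ?thesis
      using w(1) w'(1) below below'
      by (simp only: V_word_below cinner_tens xi_in elt_in_below cinner_xi_xi mult_1)
  next
    case (equal f' v')
    have "cinner (xi k) f' = 0"
      using equal(2) cinner_eq_zero_commute by (auto simp: ominus_def)
    moreover have "cinner (elt w) (elt w') = 0"
      using w(1) w'(1) below by (intro below_elt_orthogonal[of _ k] elt_in_below) (auto simp: equal)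
    ultimately show ?thesis
      using w(1) below equal
      by (simp only: V_word_below V_word_Cons cinner_tens xi_in elt_in_below ominus_def
          mem_Collect_eq mult_zero_left)
  qed (use w' in auto)
next
  case (equal f v)
  show ?thesis using w'(1)
  proof (cases rule: mono_words_cases[where k = k])
    case below': below
    have "cinner (elt w') (elt w) = 0"
      using w(1) w'(1) below' by (intro below_elt_orthogonal[of _ k] elt_in_below) (auto simp: equal)
    then have "cinner (elt w) (elt w') = 0" using cinner_eq_zero_commute by blast
    then show ?thesis
      using w'(1) below' equal
      by (simp only: V_word_below V_word_Cons cinner_tens xi_in elt_in_below ominus_def
          mem_Collect_eq mult_zero_left)
  next
    case equal': (equal f' v')
    show ?thesis
      using w(1) w'(1) equal equal'
      by (simp only: cinner_elt_Cons V_word_Cons cinner_tens elt_in_below ominus_def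
          mem_Collect_eq)
  qed (use w' in auto)
qed (use w in auto)

text \<open>The property selected by \<open>SOME\<close> in \<open>V\<close>, named so that
  existence and uniqueness can be treated separately.\<close>

definition is_V :: "'i \<Rightarrow> ('m \<Rightarrow> 'k) \<Rightarrow> bool" where
  "is_V k v \<longleftrightarrow> bounded_op UNIV (tens_space k) v \<and>
     v vacuum = tens k (xi k) vacuum \<and>
     (\<forall>i f w. (i, f) # w \<in> words \<longrightarrow>
        v (elt ((i, f) # w)) =
          (if i > k then 0
           else if i = k then tens k f (elt w)
           else tens k (xi k) (elt ((i, f) # w))))"

text \<open>The prescribed values on the total set of elementary tensors leave no freedom. Hence
  what is proved about a constructed operator transfers to the chosen \<open>V k\<close>.\<close>

lemma is_V_unique:
  assumes "is_V k v" "is_V k v'"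
  shows "v x = v' x"
proof (rule bounded_op_eq_on_ccspan[of "elt ` words"])
  show "bounded_op (ccspan (elt ` words)) (tens_space k) v"
    "bounded_op (ccspan (elt ` words)) (tens_space k) v'"
    using assms by (simp_all add: is_V_def elt_total)
  show "x \<in> ccspan (elt ` words)" by (simp add: elt_total)
  fix y assume "y \<in> elt ` words"
  then obtain w where w: "y = elt w" "w \<in> words" by blast
  show "v y = v' y"
  proof (cases w)
    case Nil
    then show ?thesis using assms by (simp add: w is_V_def vacuum_def)
  next
    case (Cons p w')
    obtain i f where "p = (i, f)" by fastforce
    then show ?thesis using assms w unfolding is_V_def Cons by metis
  qed
qed

lemma tens_in_tens_space: "x \<in> H k \<Longrightarrow> y \<in> below k \<Longrightarrow> tens k x y \<in> tens_space k"
  unfolding tens_space_def by (intro ccspan_base) auto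

lemma V_word_in_tens_space:
  assumes "w \<in> words" "w = [] \<or> fst (hd w) \<le> k"
  shows "V_word k w \<in> tens_space k"
  using assms(1)
proof (cases rule: mono_words_cases[where k = k])
  case below
  then show ?thesis
    using assms(1) by (simp only: V_word_below) (intro tens_in_tens_space xi_in elt_in_below)
next
  case (equal f w')
  then have "f \<in> H k" by (simp add: ominus_def)
  then show ?thesis
    using equal by (simp only: V_word_Cons) (intro tens_in_tens_space elt_in_below)
qed (use assms in auto)

text \<open>The words with leading index at most \<open>k\<close> have the same Gram matrix as their
  prescribed images, so the partial isometry extension applies. It also delivers the adjoint and the
  vanishing on the orthogonal complement.\<close>

lemma is_V_exists:
  obtains v v' where "is_V k v" "bounded_op UNIV UNIV v'"
    "\<And>x. (\<And>w. w \<in> words \<Longrightarrow> w = [] \<or> fst (hd w) \<le> k \<Longrightarrow> cinner x (elt w) = 0) \<Longrightarrow> v x = 0"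
    "\<And>x y. cinner (v x) y = cinner x (v' y)"
proof -
  define A where "A = {w \<in> words. w = [] \<or> fst (hd w) \<le> k}"
  have gram: "cinner (V_word k w) (V_word k w') = cinner (elt w) (elt w')"
    if "w \<in> A" "w' \<in> A" for w w'
    using that by (intro V_word_gram) (auto simp: A_def)
  obtain v v' where v: "bounded_op UNIV (ccspan (V_word k ` A)) v"
    "bounded_op UNIV (ccspan (elt ` A)) v'"
    "\<And>w. w \<in> A \<Longrightarrow> v (elt w) = V_word k w"
    "\<And>x. (\<And>w. w \<in> A \<Longrightarrow> cinner x (elt w) = 0) \<Longrightarrow> v x = 0"
    "\<And>x y. cinner (v x) y = cinner x (v' y)"
    by (rule partial_isometry_extension[of A "V_word k" elt, OF gram])
       (assumption, assumption, rule that, assumption, assumption, assumption, blast)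
  have "ccspan (V_word k ` A) \<subseteq> tens_space k"
    unfolding tens_space_def
    by (rule ccspan_minimal[OF _ closed_csubspace_ccspan])
       (use V_word_in_tens_space in \<open>auto simp: A_def tens_space_def\<close>)
  then have bnd: "bounded_op UNIV (tens_space k) v" using bounded_op_mono[OF v(1)] by blast
  have "is_V k v"
    unfolding is_V_def
  proof (intro conjI allI impI)
    show "v vacuum = tens k (xi k) vacuum"
      unfolding vacuum_def using v(3)[of "[]"] by (simp add: A_def V_word_below)
    fix i f w assume w: "(i, f) # w \<in> words"
    \<comment> \<open>Words of \<open>A\<close> are empty or start at most at \<open>k\<close>, so
      this word belongs to a summand orthogonal to all of them.\<close>
    have "v (elt ((i, f) # w)) = 0" if "k < i"
    proof (rule v(4))
      fix w' assume "w' \<in> A"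
      then have "w' \<in> words" "map fst ((i, f) # w) \<noteq> map fst w'" using that
        by (auto simp: A_def)
      then show "cinner (elt ((i, f) # w)) (elt w') = 0" using w elt_orthogonal by blast
    qed
    moreover have "v (elt ((i, f) # w)) = V_word k ((i, f) # w)" if "i \<le> k"
      using that w by (intro v(3)) (simp add: A_def)
    ultimately show "v (elt ((i, f) # w)) = (if i > k then 0 else if i = k then tens k f (elt w)
        else tens k (xi k) (elt ((i, f) # w)))"
      by (auto simp: V_word_def)
  qed (rule bnd)
  then show thesis
    by (rule that[of v v'])
       (use v(2,4,5) in \<open>auto simp: A_def intro: bounded_op_mono\<close>)
qed

lemma is_V_V: "is_V k (V k)"
proof -
  have "\<exists>v. is_V k v" using is_V_exists by metis
  then show ?thesis unfolding V_def is_V_def by (rule someI_ex)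
qed

lemma bounded_op_V: "bounded_op UNIV (tens_space k) (V k)"
  using is_V_V by (simp add: is_V_def)

lemma V_above: "(i, f) # w \<in> words \<Longrightarrow> k < i \<Longrightarrow> V k (elt ((i, f) # w)) = 0"
  using is_V_V[of k] by (simp add: is_V_def)

lemma V_orthogonal:
  assumes "\<And>w. w \<in> words \<Longrightarrow> w = [] \<or> fst (hd w) \<le> k \<Longrightarrow> cinner x (elt w) = 0"
  shows "V k x = 0"
proof -
  obtain v v' where "is_V k v"
    "\<And>x. (\<And>w. w \<in> words \<Longrightarrow> w = [] \<or> fst (hd w) \<le> k \<Longrightarrow> cinner x (elt w) = 0) \<Longrightarrow> v x = 0"
    using is_V_exists[of k] by metis
  then show ?thesis using is_V_unique[OF is_V_V] assms by metis
qed

lemma V_below: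
  assumes "x \<in> below k"
  shows "V k x = tens k (xi k) x"
proof (rule bounded_op_eq_on_ccspan[of "elt ` {w \<in> words. w = [] \<or> fst (hd w) < k}"
        "tens_space k" _ UNIV])
  show "x \<in> ccspan (elt ` {w \<in> words. w = [] \<or> fst (hd w) < k})"
    using assms by (simp add: mono_below_def)
  show "bounded_op (ccspan (elt ` {w \<in> words. w = [] \<or> fst (hd w) < k})) (tens_space k) (V k)"
    by (rule bounded_op_mono[OF bounded_op_V]) auto
  show "bounded_op (ccspan (elt ` {w \<in> words. w = [] \<or> fst (hd w) < k})) UNIV (tens k (xi k))"
    using bounded_op_hilbert_tensor_right[OF tens_tensor xi_in] by (simp add: mono_below_def)
  fix y assume "y \<in> elt ` {w \<in> words. w = [] \<or> fst (hd w) < k}"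
  then obtain w where w: "y = elt w" "w \<in> words" "w = [] \<or> fst (hd w) < k" by blast
  show "V k y = tens k (xi k) y"
  proof (cases w)
    case Nil
    then show ?thesis using is_V_V[of k] by (simp add: w is_V_def vacuum_def)
  next
    case (Cons p w')
    obtain i f where "p = (i, f)" by fastforce
    then show ?thesis using is_V_V[of k] w unfolding is_V_def Cons by auto
  qed
qed

text \<open>By uniqueness \<open>V k\<close> is the constructed partial isometry, and the adjoint
  that comes with it is a witness for the choice in \<open>adjoint_op\<close>.\<close>

lemma V_adjoint:
  shows bounded_op_V_adjoint:
      "bounded_op (tens_space k) UNIV (adjoint_op UNIV (tens_space k) (V k))"
    and cinner_V_adjoint:
      "y \<in> tens_space k \<Longrightarrow>
        cinner (V k x) y = cinner x (adjoint_op UNIV (tens_space k) (V k) y)"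
proof -
  obtain v v' where v: "is_V k v" "bounded_op UNIV UNIV v'"
    "\<And>x y. cinner (v x) y = cinner x (v' y)"
    using is_V_exists[of k] by metis
  have "V k = v" using is_V_unique[OF is_V_V v(1)] by blast
  then have "bounded_op (tens_space k) UNIV v' \<and>
      (\<forall>x\<in>UNIV. \<forall>y\<in>tens_space k. cinner (V k x) y = cinner x (v' y))"
    using v bounded_op_mono[OF v(2), of "tens_space k" UNIV] by simp
  then have "\<exists>g. bounded_op (tens_space k) UNIV g \<and>
      (\<forall>x\<in>UNIV. \<forall>y\<in>tens_space k. cinner (V k x) y = cinner x (g y))"
    by blast
  from someI_ex[OF this, folded adjoint_op_def]
  show "bounded_op (tens_space k) UNIV (adjoint_op UNIV (tens_space k) (V k))"
    "y \<in> tens_space k \<Longrightarrow>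
        cinner (V k x) y = cinner x (adjoint_op UNIV (tens_space k) (V k) y)"
    by auto
qed

section \<open>The operators \<open>\<omega> k T\<close>\<close>

context
  fixes k :: 'i and T :: "'h \<Rightarrow> 'h"
  assumes T: "bounded_op (H k) (H k) T"
begin

lemma tens_id:
  shows bounded_op_tens_id: "bounded_op (tens_space k) (tens_space k) (tens_id k T)"
    and tens_id_tens: "x \<in> H k \<Longrightarrow> y \<in> below k \<Longrightarrow> tens_id k T (tens k x y) = tens k (T x) y"
proof -
  obtain R where "bounded_op (tens_space k) (tens_space k) R"
    "\<And>x y. x \<in> H k \<Longrightarrow> y \<in> below k \<Longrightarrow> R (tens k x y) = tens k (T x) y"
    by (rule bounded_op_tensor_id[OF tens_tensor csubspace_H csubspace_below T,
          folded tens_space_def]) (rule that)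
  then have "\<exists>R. bounded_op (tens_space k) (tens_space k) R \<and>
     (\<forall>x\<in>H k. \<forall>y\<in>below k. R (tens k x y) = tens k (T x) y)" by blast
  from someI_ex[OF this, folded tens_id_def]
  show "bounded_op (tens_space k) (tens_space k) (tens_id k T)"
    "x \<in> H k \<Longrightarrow> y \<in> below k \<Longrightarrow> tens_id k T (tens k x y) = tens k (T x) y" by auto
qed

lemma bounded_op_\<omega>: "bounded_op UNIV UNIV (\<omega> k T)"
  unfolding \<omega>_def comp_def
  by (rule bounded_op_compose[OF bounded_op_compose[OF bounded_op_V bounded_op_tens_id]
        bounded_op_V_adjoint])

lemma cinner_\<omega>: "cinner (\<omega> k T x) y = cinner (tens_id k T (V k x)) (V k y)"
proof -
  have "tens_id k T (V k x) \<in> tens_space k"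
    by (intro bounded_op_in[OF bounded_op_tens_id] bounded_op_in[OF bounded_op_V]) simp
  from cinner_V_adjoint[OF this, of y] show ?thesis
    by (metis cinner_commute \<omega>_def comp_apply)
qed

lemma cinner_\<omega>_below:
  assumes "x \<in> below k" "y \<in> below k"
  shows "cinner (\<omega> k T x) y = cinner (T (xi k)) (xi k) * cinner x y"
  using assms bounded_op_in[OF T xi_in]
  by (simp add: cinner_\<omega> V_below tens_id_tens xi_in cinner_tens)

text \<open>\<open>V k\<close> kills every word with leading index at least \<open>m\<close>, as
  this exceeds \<open>k\<close>. So the range of \<open>\<omega> k T\<close> is orthogonal to those
  words, and the remaining ones generate \<open>below m\<close>.\<close>

lemma \<omega>_in_below:
  assumes "k < m"
  shows "\<omega> k T x \<in> below m"
  unfolding mono_below_def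
proof (rule mem_ccspan_if_orthogonal)
  let ?Y = "{w \<in> words. w \<noteq> [] \<and> m \<le> fst (hd w)}"
  have "elt ` {w \<in> words. w = [] \<or> fst (hd w) < m} \<union> elt ` ?Y = elt ` words"
    unfolding image_Un[symmetric] by (rule arg_cong[where f = "image elt"]) auto
  then show "ccspan (elt ` {w \<in> words. w = [] \<or> fst (hd w) < m} \<union> elt ` ?Y) = UNIV"
    by (simp add: elt_total)
  show "cinner y z = 0"
    if "y \<in> elt ` {w \<in> words. w = [] \<or> fst (hd w) < m}" "z \<in> elt ` ?Y" for y z
    using that by (auto intro!: below_elt_orthogonal[of _ m] elt_in_below)
  fix z assume "z \<in> elt ` ?Y"
  then obtain w where w: "z = elt w" "w \<in> words" "w \<noteq> []" "m \<le> fst (hd w)" by blast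
  then obtain i f w' where w': "w = (i, f) # w'" by (metis list.exhaust surj_pair)
  then have "V k z = 0" using w assms V_above[of i f w' k] by simp
  then show "cinner (\<omega> k T x) z = 0" by (simp add: cinner_\<omega>)
qed

text \<open>\<open>below m\<close> contains the vacuum and every word with leading index at most
  \<open>k\<close>, so \<open>V k\<close> already annihilates \<open>x\<close>.\<close>

lemma \<omega>_orthogonal:
  assumes "k < m" "\<And>y. y \<in> below m \<Longrightarrow> cinner x y = 0"
  shows "\<omega> k T x = 0"
proof -
  have "V k x = 0"
    using assms elt_in_below[of _ m] by (intro V_orthogonal) (auto intro: le_less_trans)
  then have "cinner (\<omega> k T x) (\<omega> k T x) = 0"
    using bounded_op_zero[OF bounded_op_tens_id] by (simp add: cinner_\<omega> tens_space_def)
  then show ?thesis by simp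
qed

end

section \<open>The projections \<open>P k\<close>\<close>

abbreviation P_space :: "'i \<Rightarrow> 'm set" where
  "P_space k \<equiv> ccspan (insert vacuum {elt [(k, f)] | f. f \<in> ominus H xi k})"

lemma bounded_op_P: "bounded_op UNIV (P_space k) (P k)"
  unfolding P_def by (rule bounded_op_orth_proj[OF closed_csubspace_ccspan])

text \<open>Only the vacuum direction of \<open>P_space k\<close> is visible from
  \<open>below k\<close>: the vectors \<open>elt [(k, f)]\<close> are orthogonal to
  \<open>below k\<close>.\<close>

lemma P_below:
  assumes x: "x \<in> below k"
  shows "P k x = cinner x vacuum *\<^sub>C vacuum"
  unfolding P_def
proof (rule orth_proj_eqI)
  have vac: "vacuum \<in> P_space k" by (intro ccspan_base) simp
  then show "cinner x vacuum *\<^sub>C vacuum \<in> P_space k" by (intro csubspace_scaleC) simp_all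
  fix z assume "z \<in> P_space k"
  then show "cinner (x - cinner x vacuum *\<^sub>C vacuum) z = 0"
  proof (rule orthogonal_ccspan[rotated])
    fix z assume z: "z \<in> insert vacuum {elt [(k, f)] | f. f \<in> ominus H xi k}"
    show "cinner (x - cinner x vacuum *\<^sub>C vacuum) z = 0"
    proof (cases "z = vacuum")
      case True
      then show ?thesis by (simp add: cinner_diff_left cinner_scaleC_left cinner_vacuum_vacuum)
    next
      case False
      then obtain f where f: "z = elt [(k, f)]" "f \<in> ominus H xi k" using z by blast
      have "x - cinner x vacuum *\<^sub>C vacuum \<in> below k"
        using x by (intro csubspace_diff[OF csubspace_below] csubspace_scaleC[OF csubspace_below]
            vacuum_in_below)
      then show ?thesis
        unfolding f(1) by (rule below_elt_orthogonal) (simp_all add: f mono_words_Cons)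
    qed
  qed
qed simp

text \<open>The space onto which \<open>P k\<close> projects lies inside
  \<open>below m\<close>.\<close>

lemma P_orthogonal:
  assumes "k < m" "\<And>y. y \<in> below m \<Longrightarrow> cinner x y = 0"
  shows "P k x = 0"
  unfolding P_def
proof (rule orth_proj_eqI)
  fix z assume "z \<in> P_space k"
  then show "cinner (x - 0) z = 0"
  proof (rule orthogonal_ccspan[rotated])
    fix z assume "z \<in> insert vacuum {elt [(k, f)] | f. f \<in> ominus H xi k}"
    then have "z \<in> below m"
      using assms(1) by (auto simp: mono_words_Cons intro!: vacuum_in_below elt_in_below)
    then show "cinner (x - 0) z = 0" using assms(2) by simp
  qed
qed (simp_all add: csubspace_0)

section \<open>The operators \<open>j_rep \<pi> \<sigma> k a\<close>\<close>

context
  fixes \<pi> \<sigma> :: "'i \<Rightarrow> 'a \<Rightarrow> 'h \<Rightarrow> 'h" and k :: 'i and a :: 'a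
  assumes \<pi>: "bounded_op (H k) (H k) (\<pi> k a)" and \<sigma>: "bounded_op (H k) (H k) (\<sigma> k a)"
begin

lemma bounded_op_j_rep: "bounded_op UNIV UNIV (j_rep \<pi> \<sigma> k a)"
proof -
  \<comment> \<open>The complement \<open>x - P k x\<close> is written as
    \<open>x + (-1) *\<^sub>C P k x\<close>, so that closure under composition and sums
    suffices.\<close>
  have "bounded_op UNIV UNIV (\<lambda>x. (-1) *\<^sub>C P k x)"
    by (rule bounded_op_compose[OF bounded_op_P])
       (auto simp: bounded_op_def scaleC_add_right scaleC_scaleC mult.commute norm_scaleC
         intro!: exI[of _ 1])
  moreover have "bounded_op UNIV UNIV (\<lambda>x::'m. x)"
    unfolding bounded_op_def by (auto intro: exI[of _ 1])
  ultimately have "bounded_op UNIV UNIV (\<lambda>x. x + (-1) *\<^sub>C P k x)"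
    using bounded_op_plus by blast
  then have "bounded_op UNIV UNIV (\<lambda>x. x - P k x)" by (simp add: scaleC_minus_one)
  from bounded_op_plus[OF
      bounded_op_compose[OF bounded_op_mono[OF bounded_op_P] bounded_op_\<omega>[of k, OF \<pi>]]
      bounded_op_compose[OF this bounded_op_\<omega>[of k, OF \<sigma>]]]
  show ?thesis by (simp add: j_rep_def[abs_def])
qed

lemma j_rep_in_below: "k < m \<Longrightarrow> j_rep \<pi> \<sigma> k a x \<in> below m"
  unfolding j_rep_def
  by (intro csubspace_add[OF csubspace_below] \<omega>_in_below[OF \<pi>] \<omega>_in_below[OF \<sigma>])

lemma j_rep_orthogonal:
  assumes "k < m" "\<And>y. y \<in> below m \<Longrightarrow> cinner x y = 0"
  shows "j_rep \<pi> \<sigma> k a x = 0"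
  unfolding j_rep_def
  using P_orthogonal[OF assms] \<omega>_orthogonal[OF \<sigma> assms] bounded_op_zero[OF bounded_op_\<omega>[OF \<pi>]]
  by simp

text \<open>For \<open>x\<close> in \<open>below k\<close> both \<open>P k x\<close> and
  \<open>x - P k x\<close> stay in \<open>below k\<close>, where \<omega> acts through the scalars
  \<open>p\<close> and \<open>s\<close> when tested against \<open>below k\<close>. The result is
  \<open>p\<close> times the vacuum part of \<open>x\<close> plus \<open>s\<close> times the
  rest.\<close>

lemma cinner_j_rep_below:
  assumes x: "x \<in> below k" and y: "y \<in> below k"
  defines "p \<equiv> cinner (\<pi> k a (xi k)) (xi k)" and "s \<equiv> cinner (\<sigma> k a (xi k)) (xi k)"
  shows "cinner (j_rep \<pi> \<sigma> k a x) y
    = cinner (s *\<^sub>C x + ((p - s) * cinner x vacuum) *\<^sub>C vacuum) y"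
proof -
  have c: "cinner x vacuum *\<^sub>C vacuum \<in> below k"
    by (intro csubspace_scaleC[OF csubspace_below] vacuum_in_below)
  show ?thesis
    unfolding j_rep_def P_below[OF x] cinner_add_left
      cinner_\<omega>_below[OF \<pi> c y] cinner_\<omega>_below[OF \<sigma> csubspace_diff[OF csubspace_below x c] y]
    by (simp add: p_def s_def cinner_scaleC_left cinner_diff_left algebra_simps)
qed

end

text \<open>The two arguments of the outer operator differ by a vector orthogonal to
  \<open>below m\<close>, and the operator of smaller index annihilates such vectors.\<close>

lemma j_rep_j_rep_below:
  assumes "bounded_op (H k) (H k) (\<pi> k a)" "bounded_op (H k) (H k) (\<sigma> k a)"
    and "bounded_op (H m) (H m) (\<pi> m b)" "bounded_op (H m) (H m) (\<sigma> m b)"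
    and km: "k < m" and x: "x \<in> below m"
  defines "p \<equiv> cinner (\<pi> m b (xi m)) (xi m)" and "s \<equiv> cinner (\<sigma> m b (xi m)) (xi m)"
  shows "j_rep \<pi> \<sigma> k a (j_rep \<pi> \<sigma> m b x)
    = j_rep \<pi> \<sigma> k a (s *\<^sub>C x + ((p - s) * cinner x vacuum) *\<^sub>C vacuum)"
proof -
  let ?y = "s *\<^sub>C x + ((p - s) * cinner x vacuum) *\<^sub>C vacuum"
  have "j_rep \<pi> \<sigma> k a (j_rep \<pi> \<sigma> m b x - ?y) = 0"
    using assms by (intro j_rep_orthogonal[where m = m])
      (simp_all only: cinner_diff_left cinner_j_rep_below diff_self)
  then show ?thesis
    using bounded_op_diff[OF bounded_op_j_rep[where \<pi> = \<pi> and \<sigma> = \<sigma> and k = k and a = a]] assms(1,2)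
    by simp
qed

end

section \<open>Operator products\<close>

lemma op_prod_empty: "l < m \<Longrightarrow> op_prod X m l = id"
  by (simp add: op_prod_def)

lemma op_prod_rec: "m \<le> l \<Longrightarrow> op_prod X m l = X m \<circ> op_prod X (Suc m) l"
  unfolding op_prod_def by (subst upt_conv_Cons) (simp_all del: upt_Suc)

lemma op_prod_split:
  assumes "0 < k" "m \<le> k" "k \<le> Suc l"
  shows "op_prod X m l = op_prod X m (k - 1) \<circ> op_prod X k l"
proof -
  have *: "foldr (\<circ>) (xs @ ys) id = foldr (\<circ>) xs id \<circ> foldr (\<circ>) ys id"
    for xs ys :: "('b \<Rightarrow> 'b) list"
    by (induction xs) (simp_all add: comp_assoc)
  have "[m..<Suc l] = [m..<k] @ [k..<Suc l]"
    using assms upt_add_eq_append[of m k "Suc l - k"] by simp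
  \<comment> \<open>The first block ends at \<open>k - 1\<close>; for \<open>k = 0\<close> truncated
    subtraction would make it contain \<open>X 0\<close>.\<close>
  moreover have "Suc (k - 1) = k" using assms(1) by simp
  ultimately show ?thesis by (simp only: op_prod_def map_append *)
qed

lemma bounded_op_op_prod:
  "(\<And>k. m \<le> k \<Longrightarrow> k \<le> l \<Longrightarrow> bounded_op UNIV UNIV (X k)) \<Longrightarrow> bounded_op UNIV UNIV (op_prod X m l)"
proof (induction "Suc l - m" arbitrary: m)
  case 0
  then show ?case by (auto simp: op_prod_empty bounded_op_def intro: exI[of _ 1])
next
  case (Suc d)
  then have "bounded_op UNIV UNIV (op_prod X (Suc m) l)" by simp
  then show ?case
    using bounded_op_compose[of UNIV UNIV "op_prod X (Suc m) l" UNIV "X m"] Suc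
    by (simp add: op_prod_rec comp_def)
qed

section \<open>The three reduction formulas for vacuum moments\<close>

theorem theorem2p3:
  fixes A :: "'i::linorder \<Rightarrow> 'a star_alg"
    and \<phi> \<psi> :: "'i \<Rightarrow> 'a \<Rightarrow> complex"
    and H :: "'i \<Rightarrow> 'h::complex_hilbert_space set"
    and xi :: "'i \<Rightarrow> 'h"
    and \<pi> \<sigma> :: "'i \<Rightarrow> 'a \<Rightarrow> 'h \<Rightarrow> 'h"
    and elt :: "('i \<times> 'h) list \<Rightarrow> 'm::complex_hilbert_space"
    and tens :: "'i \<Rightarrow> 'h \<Rightarrow> 'm \<Rightarrow> 'k::complex_hilbert_space"
    and n :: nat and i :: "nat \<Rightarrow> 'i" and a :: "nat \<Rightarrow> 'a"
  assumes alg: "\<And>k. star_algebra (A k)"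
    and states: "\<And>k. is_state (A k) (\<phi> k)" "\<And>k. is_state (A k) (\<psi> k)"
    and least: "\<And>k x. \<lbrakk>\<forall>k'. k \<le> k'; x \<in> carrier (A k)\<rbrakk> \<Longrightarrow> \<phi> k x = \<psi> k x"
    and mono: "monotone_product H xi elt tens"
    and reps: "\<And>k. star_rep (A k) (H k) (\<pi> k)" "\<And>k. star_rep (A k) (H k) (\<sigma> k)"
    and vec_phi: "\<And>k x. x \<in> carrier (A k) \<Longrightarrow> \<phi> k x = cinner (\<pi> k x (xi k)) (xi k)"
    and vec_psi: "\<And>k x. x \<in> carrier (A k) \<Longrightarrow> \<psi> k x = cinner (\<sigma> k x (xi k)) (xi k)"
    and alternating: "\<And>k. \<lbrakk>1 \<le> k; k < n\<rbrakk> \<Longrightarrow> i k \<noteq> i (k + 1)"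
    and elems: "\<And>k. \<lbrakk>1 \<le> k; k \<le> n\<rbrakk> \<Longrightarrow> a k \<in> carrier (A (i k))"
  defines "J \<equiv> op_prod (\<lambda>k. monotone_product.j_rep H xi elt tens \<pi> \<sigma> (i k) (a k))"
    and "\<Phi> \<equiv> monotone_product.vacuum_state elt"
  shows "(2 \<le> n \<and> i 1 > i 2 \<longrightarrow> \<Phi> (J 1 n) = \<phi> (i 1) (a 1) * \<Phi> (J 2 n)) \<and>
    (2 \<le> n \<and> i n > i (n - 1) \<longrightarrow> \<Phi> (J 1 n) = \<Phi> (J 1 (n - 1)) * \<phi> (i n) (a n)) \<and>
    (\<forall>l. 1 < l \<and> l < n \<and> i (l - 1) < i l \<and> i l > i (l + 1) \<longrightarrow>
      \<Phi> (J 1 n) =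
        \<Phi> (J 1 (l - 1) \<circ> (\<lambda>x. \<psi> (i l) (a l) *\<^sub>C x) \<circ> J (l + 1) n)
        + \<Phi> (J 1 (l - 1)) * (\<phi> (i l) (a l) - \<psi> (i l) (a l)) * \<Phi> (J (l + 1) n))"
proof -
  interpret monotone_product H xi elt tens by (rule mono)
  define X where "X = (\<lambda>k. j_rep \<pi> \<sigma> (i k) (a k))"
  have J: "J = op_prod X" by (simp add: J_def X_def)
  have \<Phi>: "\<Phi> F = cinner (F vacuum) vacuum" for F by (simp add: \<Phi>_def vacuum_state_def)
  have \<pi>: "bounded_op (H (i k)) (H (i k)) (\<pi> (i k) (a k))"
    and \<sigma>: "bounded_op (H (i k)) (H (i k)) (\<sigma> (i k) (a k))" if "1 \<le> k" "k \<le> n" for k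
    using reps elems[OF that] by (auto simp: star_rep_def)
  define p where "p k = \<phi> (i k) (a k)" for k
  define s where "s k = \<psi> (i k) (a k)" for k
  have p: "cinner (\<pi> (i k) (a k) (xi (i k))) (xi (i k)) = p k"
    and s: "cinner (\<sigma> (i k) (a k) (xi (i k))) (xi (i k)) = s k" if "1 \<le> k" "k \<le> n" for k
    using vec_phi vec_psi elems[OF that] by (simp_all add: p_def s_def)
  have bounded_J: "bounded_op UNIV UNIV (J m l)" if "1 \<le> m" "l \<le> n" for m l
    unfolding J X_def using that by (intro bounded_op_op_prod bounded_op_j_rep \<pi> \<sigma>) auto
  have J_rec: "J m n x = X m (J (m + 1) n x)" if "m \<le> n" for m x
    using that by (simp add: J op_prod_rec)
  \<comment> \<open>For \<open>l = n\<close> the product is empty and the vector is the vacuum;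
    otherwise the leftmost factor has an index under \<open>i l\<close>, so its range lies in
    \<open>below (i l)\<close>.\<close>
  have J_below: "J (l + 1) n vacuum \<in> below (i l)" if "l = n \<or> l < n \<and> i (l + 1) < i l" for l
    using that
  proof
    assume l: "l < n \<and> i (l + 1) < i l"
    then have "l + 1 \<le> n" by simp
    then show ?thesis
      using l unfolding J_rec[OF \<open>l + 1 \<le> n\<close>] X_def by (intro j_rep_in_below \<pi> \<sigma>) auto
  qed (simp add: J op_prod_empty vacuum_in_below)
  \<comment> \<open>Admitting \<open>l = n\<close> covers the right end (ii) and the interior peaks
    (iii) by one computation: the remainder created by \<open>X l\<close> is killed by
    \<open>X (l - 1)\<close>.\<close>
  have peak: "\<Phi> (J 1 n) = s l * cinner (J 1 (l - 1) v) vacuum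
      + \<Phi> (J 1 (l - 1)) * (p l - s l) * cinner v vacuum"
    if l: "1 < l" "l \<le> n" "i (l - 1) < i l" and v: "v = J (l + 1) n vacuum" "v \<in> below (i l)" for l v
  proof -
    let ?y = "s l *\<^sub>C v + ((p l - s l) * cinner v vacuum) *\<^sub>C vacuum"
    have l1: "1 \<le> l - 1" "l - 1 \<le> n" and "1 \<le> l" using l by auto
    \<comment> \<open>The last factor \<open>X (l - 1)\<close> of the left block is split off, so
      that it acts directly on \<open>X l v\<close>; for \<open>l = 2\<close> the shortened block is
      the empty product.\<close>
    have "op_prod X (l - 1) (l - 1) = X (l - 1)"
      using op_prod_rec[of "l - 1" "l - 1" X] by (simp add: op_prod_empty)
    moreover have "op_prod X 1 (l - 1) = op_prod X 1 (l - 1 - 1) \<circ> op_prod X (l - 1) (l - 1)"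
      using l by (intro op_prod_split) auto
    ultimately have J_last: "J 1 (l - 1) x = J 1 (l - 1 - 1) (X (l - 1) x)" for x
      unfolding J by (metis comp_apply)
    have "op_prod X 1 n = op_prod X 1 (l - 1) \<circ> op_prod X l n"
      using l by (intro op_prod_split) auto
    then have "J 1 n vacuum = J 1 (l - 1) (J l n vacuum)" by (simp only: J comp_apply)
    also have "\<dots> = J 1 (l - 1 - 1) (X (l - 1) (X l v))"
      by (simp only: J_last J_rec[OF l(2)] v(1))
    also have "X (l - 1) (X l v) = X (l - 1) ?y"
      unfolding X_def p[OF \<open>1 \<le> l\<close> l(2), symmetric] s[OF \<open>1 \<le> l\<close> l(2), symmetric]
      by (intro j_rep_j_rep_below \<pi> \<sigma> l1 l v(2) \<open>1 \<le> l\<close>)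
    also have "J 1 (l - 1 - 1) (X (l - 1) ?y) = J 1 (l - 1) ?y" by (rule J_last[symmetric])
    also have "\<dots> = s l *\<^sub>C J 1 (l - 1) v
        + ((p l - s l) * cinner v vacuum) *\<^sub>C J 1 (l - 1) vacuum"
      using bounded_op_add[OF bounded_J] bounded_op_scaleC[OF bounded_J] l by simp
    finally show ?thesis
      by (simp add: \<Phi> cinner_add_left cinner_scaleC_left algebra_simps)
  qed
  show ?thesis
  proof (intro conjI allI impI)
    assume "2 \<le> n \<and> i 2 < i 1"
    then have n: "1 \<le> n" and v: "J 2 n vacuum \<in> below (i 1)"
      using J_below[of 1, unfolded one_add_one] by auto
    have "\<Phi> (J 1 n) = cinner (X 1 (J 2 n vacuum)) vacuum"
      by (simp only: \<Phi> J_rec[OF n] one_add_one)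
    \<comment> \<open>At the left end no operator precedes, but the vacuum lies in
      \<open>below (i 1)\<close>, so pairing with it removes the remainder. Both terms carry the
      same inner product with the vacuum, and \<open>s 1 + (p 1 - s 1) = p 1\<close>.\<close>
    also have "\<dots> = p 1 * cinner (J 2 n vacuum) vacuum"
      unfolding X_def
        cinner_j_rep_below[where \<pi> = \<pi> and \<sigma> = \<sigma> and k = "i 1" and a = "a 1",
          OF \<pi>[OF order_refl n] \<sigma>[OF order_refl n] v vacuum_in_below]
        p[OF order_refl n] s[OF order_refl n]
      by (simp add: cinner_add_left cinner_scaleC_left cinner_vacuum_vacuum algebra_simps)
    finally show "\<Phi> (J 1 n) = \<phi> (i 1) (a 1) * \<Phi> (J 2 n)" by (simp add: \<Phi> p_def)
  next
    assume n: "2 \<le> n \<and> i (n - 1) < i n"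
    \<comment> \<open>With the vacuum as \<open>v\<close> both terms of \<open>peak\<close> contain
      \<open>\<Phi> (J 1 (n - 1))\<close>, and the coefficients add up to
      \<open>p n\<close>.\<close>
    have "J (n + 1) n vacuum = vacuum" by (simp add: J op_prod_empty)
    then show "\<Phi> (J 1 n) = \<Phi> (J 1 (n - 1)) * \<phi> (i n) (a n)"
      using peak[of n vacuum] n
      by (simp add: vacuum_in_below \<Phi> cinner_vacuum_vacuum p_def algebra_simps)
  next
    fix l assume l: "1 < l \<and> l < n \<and> i (l - 1) < i l \<and> i (l + 1) < i l"
    \<comment> \<open>In \<open>peak\<close> the scalar stands in front, in the claim between the
      two blocks; linearity of the left block moves it.\<close>
    have "J 1 (l - 1) (s l *\<^sub>C x) = s l *\<^sub>C J 1 (l - 1) x" for x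
      by (rule bounded_op_scaleC[OF bounded_J]) (use l in auto)
    then show "\<Phi> (J 1 n) =
        \<Phi> (J 1 (l - 1) \<circ> (\<lambda>x. \<psi> (i l) (a l) *\<^sub>C x) \<circ> J (l + 1) n)
        + \<Phi> (J 1 (l - 1)) * (\<phi> (i l) (a l) - \<psi> (i l) (a l)) * \<Phi> (J (l + 1) n)"
      using peak[of l "J (l + 1) n vacuum"] J_below[of l] l
      by (simp add: \<Phi> cinner_scaleC_left flip: p_def s_def)
  qed
qed

end
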